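(* Let $x$ be an indeterminate. For each $k\ge1$ and $0\le r\le k$, as an identity of rational functions in $x$ over $\mathbb Q$, $$\det\big(\mathsf G_k^{(r)}\big)=\prod_{s=1}^{\lfloor (k-r)/2\rfloor}\left(\frac{u_{s+r}(x-1)}{u_{s-1}(x-1)}\right)^{\mathsf m_{k,r+2s}}.$$ In particular $\det\mathsf G_k^{(k)}=\det\mathsf G_k^{(k-1)}=1$, $\det\mathsf G_k^{(k-2)}=u_{k-1}(x-1)$ and $\det\mathsf G_k^{(k-3)}=u_{k-2}(x-1)^k$.
   Context: Motzkin algebra: a Motzkin $k$-diagram has top vertices $1..k$, bottom vertices $1'..k'$, edges each joining two distinct vertices, each vertex on at most one edge, edges planar. $\mathsf M_k(x)$: free module on such diagrams with product: stack $d_1$ above $d_2$, let $d_3$ join outer vertices connected by a path, $d_1d_2=x^\kappa d_3$, $\kappa$ the number of closed middle loops. Rank = number of vertical edges; $\mathsf J_{r-1}$ = span of diagrams of rank $\le r-1$. Motzkin paths: $p=(a_1,\dots,a_k)$, $a_i\in\{-1,0,1\}$, partial sums $\ge0$, rank $\sum a_i$; $\mathcal P_k^r$ those of rank $r$, $\mathsf m_{k,r}=|\mathcal P_k^r|$. Index $i$ with $a_i=1$ is paired with the smallest $j>i$ with $a_i+\dots+a_j=0$ if it exists. 1-factor of $p$: row $1..k$, paired indices joined by an edge, unpaired $a_i=1$ white, others black. For $p,q\in\mathcal P_k^r$, $d_p^q$ has bottom-row edges $i'$—$j'$ for edges $\{i,j\}$ of $p$, top-row edges $i$—$j$ for edges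 of $q$, and vertical edges joining the $s$-th white vertex of $q$ (top) to the $s$-th white vertex of $p$ (bottom); other vertices isolated. Bilinear form: $\langle p,q\rangle$ is defined by $d_p^pd_q^q\equiv\langle p,q\rangle d_q^p\pmod{\mathsf J_{r-1}}$ (so $\langle p,q\rangle=x^\kappa$ if the product has rank $r$, $\kappa$ the number of middle loops, and $0$ otherwise). $\mathsf G_k^{(r)}=(\langle p,q\rangle)_{p,q\in\mathcal P_k^r}$ (its determinant does not depend on the ordering of $\mathcal P_k^r$). Chebyshev: $u_0(y)=1$, $u_1(y)=y$, $u_m(y)=y\,u_{m-1}(y)-u_{m-2}(y)$. *)

theory Defs
  imports "HOL-Computational_Algebra.Polynomial" "HOL-Computational_Algebra.Fraction_Field"
          "HOL-Combinatorics.Permutations"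
begin

definition motzkin_paths :: "nat \<Rightarrow> nat \<Rightarrow> int list set" where
  "motzkin_paths k r = {p. length p = k \<and> set p \<subseteq> {-1, 0, 1}
      \<and> (\<forall>i\<le>k. sum_list (take i p) \<ge> 0) \<and> sum_list p = int r}"

definition motz_m :: "nat \<Rightarrow> nat \<Rightarrow> nat" where
  "motz_m k r = card (motzkin_paths k r)"

definition stp :: "int list \<Rightarrow> nat \<Rightarrow> int" where
  "stp p i = p ! (i - 1)"

definition segsum :: "int list \<Rightarrow> nat \<Rightarrow> nat \<Rightarrow> int" where
  "segsum p i j = (\<Sum>l\<in>{i..j}. stp p l)"

definition paired :: "int list \<Rightarrow> nat \<Rightarrow> nat \<Rightarrow> bool" where
  "paired p i j \<longleftrightarrow> 1 \<le> i \<and> i < j \<and> j \<le> length p \<and> stp p i = 1 \<and> segsum p i j = 0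
      \<and> (\<forall>j'. i < j' \<and> j' < j \<longrightarrow> segsum p i j' \<noteq> 0)"

definition white :: "int list \<Rightarrow> nat \<Rightarrow> bool" where
  "white p i \<longleftrightarrow> 1 \<le> i \<and> i \<le> length p \<and> stp p i = 1 \<and> \<not> (\<exists>j. paired p i j)"

definition whites :: "int list \<Rightarrow> nat list" where
  "whites p = filter (white p) [1..<length p + 1]"

datatype vtx = T nat | B nat   \<comment> \<open>top vertex i, bottom vertex i'\<close>

type_synonym diagram = "vtx set set"   \<comment> \<open>set of edges, each a 2-element set\<close>

definition dpq :: "int list \<Rightarrow> int list \<Rightarrow> diagram" where
  "dpq p q =
     {{B i, B j} | i j. paired p i j}
   \<union> {{T i, T j} | i j. paired q i j}
   \<union> {{T (whites q ! s), B (whites p ! s)} | s. s < length (whites p) \<and> s < length (whites q)}"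

datatype lvl = Up nat | Mi nat | Dn nat  \<comment> \<open>vertices of the stacked picture\<close>

fun lift1 :: "vtx \<Rightarrow> lvl" where "lift1 (T i) = Up i" | "lift1 (B i) = Mi i"
fun lift2 :: "vtx \<Rightarrow> lvl" where "lift2 (T i) = Mi i" | "lift2 (B i) = Dn i"

fun is_outer :: "lvl \<Rightarrow> bool" where
  "is_outer (Up _) = True" | "is_outer (Dn _) = True" | "is_outer (Mi _) = False"
fun lower :: "lvl \<Rightarrow> vtx" where
  "lower (Up i) = T i" | "lower (Dn i) = B i" | "lower (Mi i) = T i"

definition stackE1 :: "diagram \<Rightarrow> lvl set set" where "stackE1 d1 = (\<lambda>e. lift1 ` e) ` d1"
definition stackE2 :: "diagram \<Rightarrow> lvl set set" where "stackE2 d2 = (\<lambda>e. lift2 ` e) ` d2"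

definition adj :: "diagram \<Rightarrow> diagram \<Rightarrow> (lvl \<times> lvl) set" where
  "adj d1 d2 = {(a, b). a \<noteq> b \<and> {a, b} \<in> stackE1 d1 \<union> stackE2 d2}"

definition compose :: "diagram \<Rightarrow> diagram \<Rightarrow> diagram" where
  "compose d1 d2 = {{lower a, lower b} | a b. is_outer a \<and> is_outer b \<and> a \<noteq> b
                       \<and> (a, b) \<in> (adj d1 d2)\<^sup>*}"

text \<open>closed middle loops: connected components consisting of middle vertices
  each lying on an edge of d1 and on an edge of d2 (i.e. of degree 2)\<close>
definition touches :: "lvl set set \<Rightarrow> lvl \<Rightarrow> bool" where
  "touches E v \<longleftrightarrow> (\<exists>e\<in>E. v \<in> e)"

definition n_loops :: "diagram \<Rightarrow> diagram \<Rightarrow> nat" where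
  "n_loops d1 d2 = card {C. \<exists>v. C = (adj d1 d2)\<^sup>* `` {v}
       \<and> (\<forall>w\<in>C. \<not> is_outer w \<and> touches (stackE1 d1) w \<and> touches (stackE2 d2) w)}"

definition rank :: "diagram \<Rightarrow> nat" where
  "rank d = card {(i, j). {T i, B j} \<in> d}"

definition xf :: "rat poly fract" where "xf = Fract [:0, 1:] 1"

definition bform :: "nat \<Rightarrow> int list \<Rightarrow> int list \<Rightarrow> rat poly fract" where
  "bform r p q = (let d1 = dpq p p; d2 = dpq q q in
      if rank (compose d1 d2) = r then xf ^ n_loops d1 d2 else 0)"

text \<open>Leibniz determinant of a matrix indexed by a finite set (ordering-independent)\<close>
definition det_on :: "'a set \<Rightarrow> ('a \<Rightarrow> 'a \<Rightarrow> 'b::comm_ring_1) \<Rightarrow> 'b" where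
  "det_on S M = (\<Sum>\<pi> | \<pi> permutes S. of_int (sign \<pi>) * (\<Prod>a\<in>S. M a (\<pi> a)))"

definition gram_det :: "nat \<Rightarrow> nat \<Rightarrow> rat poly fract" where
  "gram_det k r = det_on (motzkin_paths k r) (bform r)"

fun cheb_u :: "nat \<Rightarrow> 'a::comm_ring_1 \<Rightarrow> 'a" where
  "cheb_u 0 y = 1"
| "cheb_u (Suc 0) y = y"
| "cheb_u (Suc (Suc m)) y = y * cheb_u (Suc m) y - cheb_u m y"

end

theory Submission
  imports Defs "Jordan_Normal_Form.Determinant" "HOL-Library.List_Lexorder"
begin

text \<open>
  A Motzkin path is built from the empty diagram with white vertices only by inserting cups and
  isolated vertices, so it is recorded by a word in the operators Cup and Dot, and pairing two
  words is a rewriting process that uses only planar isotopy and the loop value. The same value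
  is therefore obtained in every linear model of these relations. In the model spanned by Motzkin
  paths, with weights given by quotients of Chebyshev polynomials, the vector of a path is
  unitriangular with respect to the lexicographic order; this is an LDL-factorisation of the Gram
  matrix, and its determinant is a product of step weights, which telescopes. In the model spanned
  by sequences of colours, the pairing counts the colourings compatible with both diagrams, so it
  is a power of the number of colours with exponent the number of closed loops, or zero; this
  identifies the rewriting process with the stacking of diagrams.
\<close>

section \<open>Determinants indexed by a finite linear order\<close>

text \<open>The form is defined by connectivity in a stacked graph, the factorisation by linear
  algebra, and following all components through the removal of a single cup would be laborious.
  \<open>ev\<close> mediates: it is purely syntactic, so an exponent found by counting colourings
  over the rationals is also the exponent in the path model over rational functions. The argument x
  - 1 arises as follows. A loop at height h is a sum over three pairs of steps, and the pair of two
  flat steps always contributes exactly 1. The other two must therefore add up to x - 1 at every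
  height: w_h + 1 / w_(h-1) = x - 1 with w_0 = x - 1, which is solved by w_h = u_(h+1) / u_h. Colour
  0 stands for isolated vertices. The white vertices receive distinct nonzero colours, since two
  equal neighbours could be joined by a cap and the boundary vector would not be annihilated. One
  number of colours is enough, because a power of an integer that is at least 2 determines its
  exponent.\<close>

lemma det_on_reindex:
  assumes "bij_betw h {0..<n} S"
  shows "det_on S M = det (mat n n (\<lambda>(i, j). M (h i) (h j)))"
proof -
  let ?U = "{0..<n}"
  have inj: "inj_on h ?U" and img: "h ` ?U = S" using assms by (auto simp: bij_betw_def)
  have "det_on S M = (\<Sum>p | p permutes ?U. of_int (sign (map_permutation ?U h p)) *
      (\<Prod>a\<in>S. M a (map_permutation ?U h p a)))"
  proof -
    have "map_permutation ?U h =
        (\<lambda>\<pi> x. if x \<in> S then h (\<pi> (inv_into ?U h x)) else x)"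
      by (auto simp: fun_eq_iff map_permutation_def restrict_id_def img)
    then have "bij_betw (map_permutation ?U h) {\<pi>. \<pi> permutes ?U} {\<pi>. \<pi> permutes S}"
      using bij_betw_permutations[OF assms] by simp
    then show ?thesis
      unfolding det_on_def by (rule sum.reindex_bij_betw[symmetric])
  qed
  also have "\<dots> = (\<Sum>p | p permutes ?U. of_int (sign p) * (\<Prod>i\<in>?U. M (h i) (h (p i))))"
  proof (rule sum.cong[OF refl], goal_cases)
    case (1 p)
    then have p: "p permutes ?U" by simp
    have "(\<Prod>a\<in>S. M a (map_permutation ?U h p a)) =
        (\<Prod>i\<in>?U. M (h i) (map_permutation ?U h p (h i)))"
      unfolding img[symmetric] by (subst prod.reindex[OF inj]) simp
    also have "\<dots> = (\<Prod>i\<in>?U. M (h i) (h (p i)))"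
      by (intro prod.cong refl) (simp add: map_permutation_apply[OF inj])
    finally show ?case
      by (simp add: sign_map_permutation[OF inj p])
  qed
  also have "\<dots> = det (mat n n (\<lambda>(i, j). M (h i) (h j)))"
    by (subst det_def'[of _ n])
      (auto intro!: sum.cong prod.cong simp: permutes_in_image)
  finally show ?thesis .
qed

text \<open>The hypotheses say that M = A E A^T with A unitriangular for the order of
  \<open>S\<close> and E diagonal, so both copies of A have determinant 1.\<close>

lemma det_on_LDL:
  fixes S :: "'a::linorder set" and V :: "'a \<Rightarrow> 'a \<Rightarrow> 'b::field"
  assumes fin: "finite S"
    and tri: "\<And>p q. p \<in> S \<Longrightarrow> q \<in> S \<Longrightarrow> V p q \<noteq> 0 \<Longrightarrow> q \<le> p"
    and unit: "\<And>p. p \<in> S \<Longrightarrow> V p p = 1"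
    and M: "\<And>p q. p \<in> S \<Longrightarrow> q \<in> S \<Longrightarrow> M p q = (\<Sum>s\<in>S. D s * V p s * V q s)"
  shows "det_on S M = (\<Prod>s\<in>S. D s)"
proof -
  define n where "n = card S"
  define h where "h = (\<lambda>i. sorted_list_of_set S ! i)"
  have len: "length (sorted_list_of_set S) = n" by (simp add: n_def)
  have h: "bij_betw h {0..<n} S"
    unfolding h_def using bij_betw_nth[of "sorted_list_of_set S" "{0..<n}" S] fin len
    by (auto simp: atLeast0LessThan)
  have hS: "h i \<in> S" if "i < n" for i using h that by (auto simp: bij_betw_def)
  have hless: "h i < h j" if "i < j" "j < n" for i j
    using sorted_wrt_nth_less[OF strict_sorted_list_of_set[of S], of i j] that len
    by (simp add: h_def)
  define A where "A = mat n n (\<lambda>(i, j). V (h i) (h j))"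
  define E where "E = mat n n (\<lambda>(i, j). if i = j then D (h i) else 0)"
  have cA: "A \<in> carrier_mat n n" and cE: "E \<in> carrier_mat n n" by (auto simp: A_def E_def)
  have AE: "(A * E) $$ (i, j) = V (h i) (h j) * D (h j)" if "i < n" "j < n" for i j
  proof -
    have "(A * E) $$ (i, j) = (\<Sum>l = 0..<n. V (h i) (h l) * (if l = j then D (h l) else 0))"
      using that by (simp add: A_def E_def scalar_prod_def)
    also have "\<dots> = V (h i) (h j) * D (h j)"
      using that by (simp add: if_distrib[of "\<lambda>x. _ * x"] cong: if_cong)
    finally show ?thesis .
  qed
  have "mat n n (\<lambda>(i, j). M (h i) (h j)) = A * E * transpose_mat A" (is "?L = ?R")
  proof (rule eq_matI)
    fix i j assume "i < dim_row ?R" "j < dim_col ?R"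
    then have ij: "i < n" "j < n" by (auto simp: A_def)
    have "?R $$ (i, j) = (\<Sum>l = 0..<n. (A * E) $$ (i, l) * A $$ (j, l))"
    proof -
      have "(F * transpose_mat A) $$ (i, j) = (\<Sum>l = 0..<n. F $$ (i, l) * A $$ (j, l))"
        if "F \<in> carrier_mat n n" for F
        using ij cA that by (auto simp: scalar_prod_def intro!: sum.cong)
      then show ?thesis using mult_carrier_mat[OF cA cE] .
    qed
    also have "\<dots> = (\<Sum>l = 0..<n. D (h l) * V (h i) (h l) * V (h j) (h l))"
    proof (intro sum.cong refl)
      fix l assume "l \<in> {0..<n}"
      moreover from this ij have "A $$ (j, l) = V (h j) (h l)" by (simp add: A_def)
      ultimately show "(A * E) $$ (i, l) * A $$ (j, l) = D (h l) * V (h i) (h l) * V (h j) (h l)"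
        using ij by (simp add: AE)
    qed
    also have "\<dots> = (\<Sum>s\<in>S. D s * V (h i) s * V (h j) s)"
      using sum.reindex_bij_betw[OF h, of "\<lambda>s. D s * V (h i) s * V (h j) s"] by simp
    finally show "?L $$ (i, j) = ?R $$ (i, j)" using M[OF hS hS] ij by simp
  qed (auto simp: A_def)
  then have "det_on S M = det A * det E * det A"
    using cA cE det_on_reindex[OF h, of M]
    by (simp add: det_mult[of _ n] det_transpose[OF cA])
  moreover have "det A = 1"
  proof -
    have "det A = prod_list (diag_mat A)"
    proof (rule det_lower_triangular[OF _ cA])
      fix i j assume "i < j" "j < n"
      then show "A $$ (i, j) = 0"
        using tri[OF hS hS, of i j] hless[of i j] by (force simp: A_def)
    qed
    also have "\<dots> = (\<Prod>i = 0..<n. 1)"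
      unfolding prod_list_diag_prod using unit hS by (auto simp: A_def intro!: prod.cong)
    finally show ?thesis by simp
  qed
  moreover have "det E = (\<Prod>s\<in>S. D s)"
  proof -
    have "det E = prod_list (diag_mat E)"
      by (rule det_lower_triangular[OF _ cE]) (auto simp: E_def)
    also have "\<dots> = (\<Prod>i = 0..<n. D (h i))"
      unfolding prod_list_diag_prod by (auto simp: E_def intro!: prod.cong)
    also have "\<dots> = (\<Prod>s\<in>S. D s)" by (rule prod.reindex_bij_betw[OF h])
    finally show ?thesis .
  qed
  ultimately show ?thesis by simp
qed

section \<open>Words of cups and dots and their linear models\<close>

datatype op = Cup nat | Dot nat

text \<open>
  The transpose of \<open>Dot i\<close> (for \<open>cutw\<close>) or \<open>Cup i\<close> (for \<open>capw\<close>) is pushed through a word. The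
  result \<open>None\<close> stands for zero, because the transposes annihilate a diagram with white vertices
  only; the number returned by \<open>capw\<close> counts the loops closed on the way.
\<close>

fun cutw :: "nat \<Rightarrow> op list \<Rightarrow> op list option" where
  "cutw i [] = None"
| "cutw i (Cup j # w) =
     (if i < j then map_option ((#) (Cup (j - 1))) (cutw i w)
      else if i \<le> Suc j then Some (Dot j # w)
      else map_option ((#) (Cup j)) (cutw (i - 2) w))"
| "cutw i (Dot j # w) =
     (if i < j then map_option ((#) (Dot (j - 1))) (cutw i w)
      else if i = j then Some w
      else map_option ((#) (Dot j)) (cutw (i - 1) w))"

fun capw :: "nat \<Rightarrow> op list \<Rightarrow> (nat \<times> op list) option" where
  "capw i [] = None"
| "capw i (Cup j # w) =
     (if i + 2 \<le> j then map_option (apsnd ((#) (Cup (j - 2)))) (capw i w)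
      else if i = j then Some (1, w)
      else if i \<le> Suc j then Some (0, w)
      else map_option (apsnd ((#) (Cup j))) (capw (i - 2) w))"
| "capw i (Dot j # w) =
     (if i + 2 \<le> j then map_option (apsnd ((#) (Dot (j - 2)))) (capw i w)
      else if i \<le> j then map_option (Pair 0) (cutw i w)
      else map_option (apsnd ((#) (Dot j))) (capw (i - 1) w))"

text \<open>The letters of the first word cross the pairing as transposes, outermost letter first.
  \<open>None\<close> is a vanishing pairing and \<open>Some n\<close> means that \<open>n\<close>
  loops were closed.\<close>

fun ev :: "op list \<Rightarrow> op list \<Rightarrow> nat option" where
  "ev [] v = (if v = [] then Some 0 else None)"
| "ev (Cup i # w) v = (case capw i v of None \<Rightarrow> None
     | Some (n, v') \<Rightarrow> map_option ((+) n) (ev w v'))"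
| "ev (Dot i # w) v = (case cutw i v of None \<Rightarrow> None | Some v' \<Rightarrow> ev w v')"

text \<open>Here \<open>r\<close> is the number of white vertices at the bottom; the size is the
  length of the row that the word builds, and \<open>wword\<close> demands that each letter is
  inserted at an existing gap.\<close>

fun wsize :: "nat \<Rightarrow> op list \<Rightarrow> nat" where
  "wsize r [] = r"
| "wsize r (Cup i # w) = wsize r w + 2"
| "wsize r (Dot i # w) = wsize r w + 1"

fun wword :: "nat \<Rightarrow> op list \<Rightarrow> bool" where
  "wword r [] = True"
| "wword r (Cup i # w) = (i \<le> wsize r w \<and> wword r w)"
| "wword r (Dot i # w) = (i \<le> wsize r w \<and> wword r w)"

lemma wsize_ge: "r \<le> wsize r w"
  by (induction r w rule: wsize.induct) auto

lemma cutw_wword: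
  "cutw i w = Some w' \<Longrightarrow> wword r w \<Longrightarrow> i < wsize r w \<Longrightarrow>
    wword r w' \<and> wsize r w' + 1 = wsize r w"
proof (induction i w arbitrary: w' rule: cutw.induct)
  case (2 i j w)
  consider "i < j" | "j \<le> i" "i \<le> Suc j" | "Suc j < i" by linarith
  then show ?case
  proof cases
    case 1
    then show ?thesis using 2 by fastforce
  next
    case 3
    then show ?thesis using 2 by fastforce
  qed (use 2 in auto)
next
  case (3 i j w)
  consider "i < j" | "i = j" | "j < i" by linarith
  then show ?case
  proof cases
    case 1
    then show ?thesis using 3 by fastforce
  next
    case 3
    then show ?thesis using \<open>cutw i (Dot j # w) = Some w'\<close> 3 "3.IH" "3.prems" by fastforce
  qed (use 3 in auto)
qed simp

lemma capw_wword:
  "capw i w = Some (n, w') \<Longrightarrow> wword r w \<Longrightarrow> i + 2 \<le> wsize r w \<Longrightarrow>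
    wword r w' \<and> wsize r w' + 2 = wsize r w"
proof (induction i w arbitrary: n w' rule: capw.induct)
  case (2 i j w)
  consider "i + 2 \<le> j" | "i < j + 2" "j < i + 2" | "j + 2 \<le> i" by linarith
  then show ?case
  proof cases
    case 1
    then show ?thesis using 2 by fastforce
  next
    case 3
    then show ?thesis using 2 by fastforce
  qed (use 2 in \<open>auto split: if_splits\<close>)
next
  case (3 i j w)
  consider "i + 2 \<le> j" | "i \<le> j" "j < i + 2" | "j < i" by linarith
  then show ?case
  proof cases
    case 1
    then show ?thesis using "3.IH" "3.prems" by fastforce
  next
    case 2
    then show ?thesis using "3.prems" cutw_wword[of i w _ r] by fastforce
  next
    case 3
    then show ?thesis using "3.IH" "3.prems" by fastforce
  qed
qed simp

text \<open>
  Vectors are functions on walks. A cup inserts the steps \<open>a\<close>, \<open>b\<close> at state \<open>s\<close> with coefficient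
  \<open>cw s a b\<close>, a dot inserts the step \<open>z\<close>, and \<open>kw\<close> is the coefficient of the adjoint of a cup with
  respect to the bilinear form in which a walk has weight the product of its \<open>d\<close>.
\<close>

locale cup_model =
  fixes A :: "'s \<Rightarrow> 'a set" and nx :: "'s \<Rightarrow> 'a \<Rightarrow> 's" and z :: 'a
    and cw :: "'s \<Rightarrow> 'a \<Rightarrow> 'a \<Rightarrow> 'f::field" and d :: "'s \<Rightarrow> 'a \<Rightarrow> 'f"
    and kw :: "'s \<Rightarrow> 'a \<Rightarrow> 'a \<Rightarrow> 'f" and x :: 'f
  assumes finite_steps: "finite (A s)"
    and z_step: "z \<in> A s" and nx_z: "nx s z = s" and d_z: "d s z = 1"
    and kw_eq: "kw s a b = d s a * d (nx s a) b * cw s a b"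
    and cw_return: "cw s a b \<noteq> 0 \<Longrightarrow> a \<in> A s \<Longrightarrow> b \<in> A (nx s a) \<Longrightarrow> nx (nx s a) b = s"
    and cw_z_left: "b \<in> A s \<Longrightarrow> cw s z b = (if b = z then 1 else 0)"
    and cw_z_right: "a \<in> A s \<Longrightarrow> cw s a z = (if a = z then 1 else 0)"
    and loop_value: "(\<Sum>a\<in>A s. \<Sum>b\<in>A (nx s a). kw s a b * cw s a b) = x"
    and zigzag_right: "b \<in> A s \<Longrightarrow> c \<in> A s \<Longrightarrow>
      (\<Sum>a\<in>A (nx s c). kw s c a * cw (nx s c) a b) = (if b = c then 1 else 0)"
    and zigzag_left: "b \<in> A s \<Longrightarrow> c \<in> A s \<Longrightarrow>
      (\<Sum>a\<in>A (nx s b). cw s b a * kw (nx s b) a c) = (if b = c then 1 else 0)"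
begin

fun walk :: "'s \<Rightarrow> 'a list \<Rightarrow> bool" where
  "walk s [] = True"
| "walk s (a # \<sigma>) = (a \<in> A s \<and> walk (nx s a) \<sigma>)"

text \<open>Admissibility is left to \<open>cw\<close>: where it is nonzero,
  \<open>cw_return\<close> brings the walk back to \<open>s\<close>, so \<open>f\<close> is again
  read at a walk from \<open>s\<close>.\<close>

fun cup :: "'s \<Rightarrow> nat \<Rightarrow> ('a list \<Rightarrow> 'f) \<Rightarrow> 'a list \<Rightarrow> 'f" where
  "cup s 0 f [] = 0"
| "cup s 0 f [a] = 0"
| "cup s 0 f (a # b # \<sigma>) = cw s a b * f \<sigma>"
| "cup s (Suc i) f [] = 0"
| "cup s (Suc i) f (a # \<sigma>) = cup (nx s a) i (\<lambda>\<tau>. f (a # \<tau>)) \<sigma>"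

fun cap :: "'s \<Rightarrow> nat \<Rightarrow> ('a list \<Rightarrow> 'f) \<Rightarrow> 'a list \<Rightarrow> 'f" where
  "cap s 0 f \<sigma> = (\<Sum>a\<in>A s. \<Sum>b\<in>A (nx s a). kw s a b * f (a # b # \<sigma>))"
| "cap s (Suc i) f [] = 0"
| "cap s (Suc i) f (a # \<sigma>) = cap (nx s a) i (\<lambda>\<tau>. f (a # \<tau>)) \<sigma>"

text \<open>No state is passed on, since the neutral step keeps the state and has coefficient 1
  everywhere.\<close>

fun dot :: "nat \<Rightarrow> ('a list \<Rightarrow> 'f) \<Rightarrow> 'a list \<Rightarrow> 'f" where
  "dot i f [] = 0"
| "dot 0 f (a # \<sigma>) = (if a = z then f \<sigma> else 0)"
| "dot (Suc i) f (a # \<sigma>) = dot i (\<lambda>\<tau>. f (a # \<tau>)) \<sigma>"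

fun cut :: "nat \<Rightarrow> ('a list \<Rightarrow> 'f) \<Rightarrow> 'a list \<Rightarrow> 'f" where
  "cut 0 f \<sigma> = f (z # \<sigma>)"
| "cut (Suc i) f [] = 0"
| "cut (Suc i) f (a # \<sigma>) = cut i (\<lambda>\<tau>. f (a # \<tau>)) \<sigma>"

fun bil :: "'s \<Rightarrow> nat \<Rightarrow> ('a list \<Rightarrow> 'f) \<Rightarrow> ('a list \<Rightarrow> 'f) \<Rightarrow> 'f" where
  "bil s 0 f g = f [] * g []"
| "bil s (Suc n) f g =
     (\<Sum>a\<in>A s. d s a * bil (nx s a) n (\<lambda>\<tau>. f (a # \<tau>)) (\<lambda>\<tau>. g (a # \<tau>)))"

fun vec :: "'s \<Rightarrow> ('a list \<Rightarrow> 'f) \<Rightarrow> op list \<Rightarrow> 'a list \<Rightarrow> 'f" where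
  "vec s \<beta> [] = \<beta>"
| "vec s \<beta> (Cup i # w) = cup s i (vec s \<beta> w)"
| "vec s \<beta> (Dot i # w) = dot i (vec s \<beta> w)"

lemma kw_return: "kw s a b \<noteq> 0 \<Longrightarrow> a \<in> A s \<Longrightarrow> b \<in> A (nx s a) \<Longrightarrow> nx (nx s a) b = s"
  by (rule cw_return) (auto simp: kw_eq)

lemma kw_z_left: "b \<in> A s \<Longrightarrow> kw s z b = (if b = z then 1 else 0)"
  by (simp add: kw_eq nx_z d_z cw_z_left)

lemma kw_z_right: "a \<in> A s \<Longrightarrow> kw s a z = (if a = z then 1 else 0)"
  by (simp add: kw_eq nx_z d_z cw_z_right)

section \<open>Linearity, and congruence along walks\<close>

lemma cup_scale: "cup s i (\<lambda>\<tau>. k * f \<tau>) \<sigma> = k * cup s i f \<sigma>"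
  by (induction s i f \<sigma> rule: cup.induct) auto

lemma cup_zero: "cup s i (\<lambda>\<tau>. 0) \<sigma> = 0"
  using cup_scale[of s i 0 "\<lambda>\<tau>. 0"] by simp

lemma cup_add: "cup s i (\<lambda>\<tau>. f \<tau> + g \<tau>) \<sigma> = cup s i f \<sigma> + cup s i g \<sigma>"
  by (induction s i f \<sigma> arbitrary: g rule: cup.induct) (auto simp: distrib_left)

lemma cup_sum: "cup s i (\<lambda>\<tau>. \<Sum>a\<in>X. F a \<tau>) \<sigma> = (\<Sum>a\<in>X. cup s i (F a) \<sigma>)"
  by (induction X rule: infinite_finite_induct) (auto simp: cup_zero cup_add)

lemma dot_add: "dot i (\<lambda>\<tau>. f \<tau> + g \<tau>) \<sigma> = dot i f \<sigma> + dot i g \<sigma>"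
  by (induction i f \<sigma> arbitrary: g rule: dot.induct) auto

lemma dot_scale: "dot i (\<lambda>\<tau>. k * f \<tau>) \<sigma> = k * dot i f \<sigma>"
  by (induction i f \<sigma> rule: dot.induct) auto

lemma dot_zero: "dot i (\<lambda>\<tau>. 0) \<sigma> = 0"
  using dot_scale[of i 0 "\<lambda>\<tau>. 0"] by simp

lemma dot_sum: "dot i (\<lambda>\<tau>. \<Sum>a\<in>X. F a \<tau>) \<sigma> = (\<Sum>a\<in>X. dot i (F a) \<sigma>)"
  by (induction X rule: infinite_finite_induct) (auto simp: dot_zero dot_add)

lemma cap_scale: "cap s i (\<lambda>\<tau>. k * f \<tau>) \<sigma> = k * cap s i f \<sigma>"
  by (induction s i f \<sigma> rule: cap.induct) (auto simp: sum_distrib_left ac_simps)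

lemma cap_zero: "cap s i (\<lambda>\<tau>. 0) \<sigma> = 0"
  using cap_scale[of s i 0 "\<lambda>\<tau>. 0"] by simp

lemma cut_scale: "cut i (\<lambda>\<tau>. k * f \<tau>) \<sigma> = k * cut i f \<sigma>"
  by (induction i f \<sigma> rule: cut.induct) auto

lemma cut_zero: "cut i (\<lambda>\<tau>. 0) \<sigma> = 0"
  using cut_scale[of i 0 "\<lambda>\<tau>. 0"] by simp

text \<open>The evaluation of words holds only at walks of the right length, so rewriting below a
  cup needs this restricted congruence.\<close>

lemma cup_cong:
  assumes "walk s \<sigma>" "\<And>\<tau>. walk s \<tau> \<Longrightarrow> length \<tau> + 2 = length \<sigma> \<Longrightarrow> f \<tau> = g \<tau>"
  shows "cup s i f \<sigma> = cup s i g \<sigma>"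
  using assms
proof (induction s i f \<sigma> arbitrary: g rule: cup.induct)
  case (3 s f a b \<sigma>)
  show ?case
  proof (cases "cw s a b = 0")
    case False
    with 3 cw_return[OF False] show ?thesis by auto
  qed simp
qed auto

lemma dot_cong:
  assumes "walk s \<sigma>" "\<And>\<tau>. walk s \<tau> \<Longrightarrow> length \<tau> + 1 = length \<sigma> \<Longrightarrow> f \<tau> = g \<tau>"
  shows "dot i f \<sigma> = dot i g \<sigma>"
  using assms
proof (induction i f \<sigma> arbitrary: s g rule: dot.induct)
  case (2 f a \<sigma>)
  then show ?case by (cases "a = z") (simp_all add: nx_z)
next
  case (3 i f a \<sigma>)
  show ?case using 3(1)[of "nx s a" "\<lambda>\<tau>. g (a # \<tau>)"] 3(2,3) by simp
qed simp

lemma bil_cong: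
  assumes "\<And>\<tau>. walk s \<tau> \<Longrightarrow> length \<tau> = n \<Longrightarrow> f \<tau> = f' \<tau>"
    and "\<And>\<tau>. walk s \<tau> \<Longrightarrow> length \<tau> = n \<Longrightarrow> g \<tau> = g' \<tau>"
  shows "bil s n f g = bil s n f' g'"
  using assms
proof (induction n arbitrary: s f f' g g')
  case (Suc n)
  have "bil (nx s a) n (\<lambda>\<tau>. f (a # \<tau>)) (\<lambda>\<tau>. g (a # \<tau>)) =
      bil (nx s a) n (\<lambda>\<tau>. f' (a # \<tau>)) (\<lambda>\<tau>. g' (a # \<tau>))" if "a \<in> A s" for a
    by (rule Suc.IH) (use that Suc.prems in simp_all)
  then show ?case by (simp cong: sum.cong)
qed simp

lemma bil_zero: "bil s n (\<lambda>\<tau>. 0) g = 0" "bil s n f (\<lambda>\<tau>. 0) = 0"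
  by (induction n arbitrary: s f g) auto

lemma bil_scale: "bil s n (\<lambda>\<tau>. k * f \<tau>) g = k * bil s n f g"
    "bil s n f (\<lambda>\<tau>. k * g \<tau>) = k * bil s n f g"
  by (induction n arbitrary: s f g) (auto simp: sum_distrib_left ac_simps)

lemma bil_add: "bil s n f (\<lambda>\<tau>. g \<tau> + h \<tau>) = bil s n f g + bil s n f h"
  by (induction n arbitrary: s f g h) (auto simp: sum.distrib algebra_simps)

lemma bil_sum: "bil s n f (\<lambda>\<tau>. \<Sum>a\<in>X. F a \<tau>) = (\<Sum>a\<in>X. bil s n f (F a))"
  by (induction X rule: infinite_finite_induct) (auto simp: bil_zero bil_add)

text \<open>Adjointness is the purpose of \<open>kw\<close>: it absorbs the weights of the two
  inserted steps, which are missing from the shorter form.\<close>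

lemma bil_cup: "bil s (n + 2) (cup s i f) g = bil s n f (cap s i g)"
proof (induction i arbitrary: s n f g)
  case 0
  have "d s a * (d (nx s a) b * bil (nx (nx s a) b) n (\<lambda>\<tau>. cw s a b * f \<tau>) (\<lambda>\<tau>. g (a # b # \<tau>)))
      = kw s a b * bil s n f (\<lambda>\<tau>. g (a # b # \<tau>))"
    if "a \<in> A s" "b \<in> A (nx s a)" for a b
    using that cw_return[of s a b]
    by (cases "cw s a b = 0") (auto simp: bil_zero bil_scale kw_eq)
  then show ?case
    by (simp add: sum_distrib_left bil_sum bil_scale cong: sum.cong)
next
  case (Suc i)
  show ?case
  proof (cases n)
    case 0
    \<comment> \<open>A cup placed after the first step needs at least three steps, so both sides
      vanish at this shortest length.\<close>
    have "cup s' i f \<sigma> = 0" if "length \<sigma> = 1" for s' i f \<sigma>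
      using that by (cases i; cases \<sigma>; cases "i - 1") auto
    then have "cup s (Suc i) f \<sigma> = 0" if "length \<sigma> = 2" for \<sigma>
      using that by (cases \<sigma>) auto
    then have "bil s 2 (cup s (Suc i) f) g = bil s 2 (\<lambda>\<tau>. 0) g"
      by (intro bil_cong) auto
    then show ?thesis
      by (simp only: 0 add_0 bil_zero bil.simps(1) cap.simps mult_zero_right)
  next
    case (Suc m)
    have "bil s (Suc (m + 2)) (cup s (Suc i) f) g =
        (\<Sum>a\<in>A s. d s a * bil (nx s a) (m + 2) (cup (nx s a) i (\<lambda>\<tau>. f (a # \<tau>))) (\<lambda>\<tau>. g (a # \<tau>)))"
      by (simp only: bil.simps cup.simps)
    then show ?thesis by (simp only: Suc.IH Suc add_Suc bil.simps cap.simps)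
  qed
qed

lemma bil_dot: "bil s (n + 1) (dot i f) g = bil s n f (cut i g)"
proof (induction i arbitrary: s n f g)
  case 0
  have "d s a * bil (nx s a) n (\<lambda>\<tau>. if a = z then f \<tau> else 0) (\<lambda>\<tau>. g (a # \<tau>))
     = (if a = z then bil s n f (\<lambda>\<tau>. g (z # \<tau>)) else 0)" for a
    by (auto simp: bil_zero nx_z d_z)
  then show ?case
    by (simp add: finite_steps z_step)
next
  case (Suc i)
  show ?case
  proof (cases n)
    case 0
    then show ?thesis by simp
  next
    case (Suc m)
    have "bil s (Suc (m + 1)) (dot (Suc i) f) g =
        (\<Sum>a\<in>A s. d s a * bil (nx s a) (m + 1) (dot i (\<lambda>\<tau>. f (a # \<tau>))) (\<lambda>\<tau>. g (a # \<tau>)))"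
      by (simp only: bil.simps dot.simps)
    then show ?thesis by (simp only: Suc.IH Suc add_Suc bil.simps cut.simps)
  qed
qed


section \<open>Relations between caps, cuts, cups and dots\<close>

lemma cap_cup_same:
  "i \<le> length \<sigma> \<Longrightarrow> cap s i (cup s i f) \<sigma> = x * f \<sigma>"
proof (induction i arbitrary: s f \<sigma>)
  case 0
  have "cap s 0 (cup s 0 f) \<sigma> = (\<Sum>a\<in>A s. \<Sum>b\<in>A (nx s a). kw s a b * cw s a b * f \<sigma>)"
    by (simp add: mult.assoc)
  also have "\<dots> = x * f \<sigma>"
    by (simp only: sum_distrib_right[symmetric] loop_value)
  finally show ?case .
next
  case (Suc i)
  then show ?case by (cases \<sigma>) auto
qed

text \<open>Overlapping in one strand, a cap and a cup straighten to the identity.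
  \<open>zigzag_right\<close> is this relation at the left end; the induction carries it past the
  earlier steps.\<close>

lemma cap_cup_right:
  "walk s \<sigma> \<Longrightarrow> i < length \<sigma> \<Longrightarrow> cap s i (cup s (Suc i) f) \<sigma> = f \<sigma>"
proof (induction i arbitrary: s f \<sigma>)
  case 0
  then obtain b \<tau> where \<sigma>: "\<sigma> = b # \<tau>" "b \<in> A s" by (cases \<sigma>) auto
  have "cap s 0 (cup s (Suc 0) f) \<sigma> =
      (\<Sum>c\<in>A s. (\<Sum>a\<in>A (nx s c). kw s c a * cw (nx s c) a b) * f (c # \<tau>))"
    by (simp add: \<sigma> mult.assoc sum_distrib_right)
  also have "\<dots> = (\<Sum>c\<in>A s. if c = b then f (c # \<tau>) else 0)"
    using \<sigma> by (intro sum.cong) (auto simp: zigzag_right)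
  finally show ?case using \<sigma> by (simp add: finite_steps)
next
  case (Suc i)
  then show ?case by (cases \<sigma>) auto
qed

lemma cap_cup_left:
  "walk s \<sigma> \<Longrightarrow> i < length \<sigma> \<Longrightarrow> cap s (Suc i) (cup s i f) \<sigma> = f \<sigma>"
proof (induction i arbitrary: s f \<sigma>)
  case 0
  then obtain b \<tau> where \<sigma>: "\<sigma> = b # \<tau>" "b \<in> A s" by (cases \<sigma>) auto
  \<comment> \<open>Where the cup contributes, its two steps return to \<open>s\<close>; the inner
    sum then runs over \<open>A s\<close> for every \<open>a\<close>, and the sums can be
    exchanged.\<close>
  have ret: "(\<Sum>c\<in>A (nx (nx s b) a). kw (nx s b) a c * (cw s b a * f (c # \<tau>))) =
      (\<Sum>c\<in>A s. cw s b a * kw (nx s b) a c * f (c # \<tau>))" if "a \<in> A (nx s b)" for a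
    using cw_return[of s b a] that \<sigma> by (cases "cw s b a = 0") (auto simp: ac_simps)
  have "cap s (Suc 0) (cup s 0 f) \<sigma> =
      (\<Sum>a\<in>A (nx s b). \<Sum>c\<in>A s. cw s b a * kw (nx s b) a c * f (c # \<tau>))"
    by (simp add: \<sigma> ret cong: sum.cong)
  also have "\<dots> = (\<Sum>c\<in>A s. (\<Sum>a\<in>A (nx s b). cw s b a * kw (nx s b) a c) * f (c # \<tau>))"
    by (subst sum.swap) (simp add: sum_distrib_right)
  also have "\<dots> = (\<Sum>c\<in>A s. if c = b then f (c # \<tau>) else 0)"
    using \<sigma> by (intro sum.cong) (auto simp: zigzag_left)
  finally show ?case using \<sigma> by (simp add: finite_steps)
next
  case (Suc i)
  then show ?case by (cases \<sigma>) auto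
qed

text \<open>Distant operators slide past each other. The gap is \<open>k\<close>, and the shift by 2
  is the width of the pair removed by the cap.\<close>

lemma cap_cup_above: "cap s i (cup s (i + k + 2) f) \<sigma> = cup s (i + k) (cap s i f) \<sigma>"
proof (induction i arbitrary: s f \<sigma>)
  case 0
  have *: "kw s a b * cup (nx (nx s a) b) k (\<lambda>\<tau>. f (a # b # \<tau>)) \<sigma> =
      kw s a b * cup s k (\<lambda>\<tau>. f (a # b # \<tau>)) \<sigma>" if "a \<in> A s" "b \<in> A (nx s a)" for a b
    using kw_return[of s a b] that by (cases "kw s a b = 0") auto
  show ?case by (simp add: cup_sum cup_scale) (intro sum.cong refl *)
next
  case (Suc i)
  show ?case
  proof (cases \<sigma>)
    case (Cons a \<tau>)
    then show ?thesis using Suc.IH[of "nx s a" "\<lambda>\<tau>. f (a # \<tau>)" \<tau>] by simp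
  qed simp
qed

lemma cap_cup_below:
  "walk s \<sigma> \<Longrightarrow> cap s (j + k + 2) (cup s j f) \<sigma> = cup s j (cap s (j + k) f) \<sigma>"
proof (induction j arbitrary: s f \<sigma>)
  case 0
  show ?case
  proof (cases \<sigma>)
    case (Cons a \<tau>)
    show ?thesis
    proof (cases \<tau>)
      case (Cons b \<rho>)
      then show ?thesis using cw_return[of s a b] 0 \<open>\<sigma> = a # \<tau>\<close>
        by (cases "cw s a b = 0") (auto simp: cap_scale cap_zero)
    qed (simp add: Cons)
  qed simp
next
  case (Suc j)
  then show ?case by (cases \<sigma>) auto
qed

text \<open>Joining an isolated point to its neighbour isolates the neighbour, because
  \<open>kw s z b\<close> vanishes unless \<open>b = z\<close>.\<close>

lemma cap_dot_same: "walk s \<sigma> \<Longrightarrow> cap s i (dot i f) \<sigma> = cut i f \<sigma>"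
proof (induction i arbitrary: s f \<sigma>)
  case 0
  have "cap s 0 (dot 0 f) \<sigma> =
      (\<Sum>a\<in>A s. if a = z then \<Sum>b\<in>A (nx s a). kw s a b * f (b # \<sigma>) else 0)"
    by (auto intro!: sum.cong)
  also have "\<dots> = (\<Sum>b\<in>A s. kw s z b * f (b # \<sigma>))"
    by (simp add: finite_steps z_step nx_z)
  also have "\<dots> = (\<Sum>b\<in>A s. if b = z then f (b # \<sigma>) else 0)"
    by (intro sum.cong) (auto simp: kw_z_left)
  finally show ?case by (simp add: finite_steps z_step)
next
  case (Suc i)
  then show ?case by (cases \<sigma>) auto
qed

lemma cap_dot_right: "walk s \<sigma> \<Longrightarrow> cap s i (dot (Suc i) f) \<sigma> = cut i f \<sigma>"
proof (induction i arbitrary: s f \<sigma>)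
  case 0
  have "cap s 0 (dot (Suc 0) f) \<sigma> =
      (\<Sum>a\<in>A s. \<Sum>b\<in>A (nx s a). if b = z then kw s a b * f (a # \<sigma>) else 0)"
    by (auto intro!: sum.cong)
  also have "\<dots> = (\<Sum>a\<in>A s. kw s a z * f (a # \<sigma>))"
    by (simp add: finite_steps z_step)
  also have "\<dots> = (\<Sum>a\<in>A s. if a = z then f (a # \<sigma>) else 0)"
    by (intro sum.cong) (auto simp: kw_z_right)
  finally show ?case by (simp add: finite_steps z_step)
next
  case (Suc i)
  then show ?case by (cases \<sigma>) auto
qed

lemma cap_dot_above: "cap s i (dot (i + k + 2) f) \<sigma> = dot (i + k) (cap s i f) \<sigma>"
proof (induction i arbitrary: s f \<sigma>)
  case 0
  show ?case by (simp add: dot_sum dot_scale)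
next
  case (Suc i)
  show ?case
  proof (cases \<sigma>)
    case (Cons a \<tau>)
    then show ?thesis using Suc.IH[of "nx s a" "\<lambda>\<tau>. f (a # \<tau>)" \<tau>] by simp
  qed simp
qed

lemma cap_dot_below: "cap s (j + k + 1) (dot j f) \<sigma> = dot j (cap s (j + k) f) \<sigma>"
proof (induction j arbitrary: s f \<sigma>)
  case 0
  show ?case by (cases \<sigma>) (auto simp: nx_z cap_zero)
next
  case (Suc j)
  then show ?case by (cases \<sigma>) auto
qed

lemma cut_cup_same: "walk s \<sigma> \<Longrightarrow> cut i (cup s i f) \<sigma> = dot i f \<sigma>"
proof (induction i arbitrary: s f \<sigma>)
  case 0
  then show ?case by (cases \<sigma>) (auto simp: cw_z_left)
next
  case (Suc i)
  then show ?case by (cases \<sigma>) auto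
qed

lemma cut_cup_right: "walk s \<sigma> \<Longrightarrow> cut (Suc i) (cup s i f) \<sigma> = dot i f \<sigma>"
proof (induction i arbitrary: s f \<sigma>)
  case 0
  then show ?case by (cases \<sigma>) (auto simp: cw_z_right)
next
  case (Suc i)
  then show ?case by (cases \<sigma>) auto
qed

lemma cut_cup_above: "cut i (cup s (i + k + 1) f) \<sigma> = cup s (i + k) (cut i f) \<sigma>"
proof (induction i arbitrary: s f \<sigma>)
  case 0
  show ?case by (simp add: nx_z)
next
  case (Suc i)
  then show ?case by (cases \<sigma>) auto
qed

lemma cut_cup_below: "cut (j + k + 2) (cup s j f) \<sigma> = cup s j (cut (j + k) f) \<sigma>"
proof (induction j arbitrary: s f \<sigma>)
  case 0
  show ?case
  proof (cases \<sigma>)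
    case (Cons a \<tau>)
    show ?thesis by (cases \<tau>) (auto simp: Cons cut_scale)
  qed simp
next
  case (Suc j)
  then show ?case by (cases \<sigma>) auto
qed

lemma cut_dot_same: "i \<le> length \<sigma> \<Longrightarrow> cut i (dot i f) \<sigma> = f \<sigma>"
proof (induction i arbitrary: f \<sigma>)
  case (Suc i)
  then show ?case by (cases \<sigma>) auto
qed simp

lemma cut_dot_above: "cut i (dot (i + k + 1) f) \<sigma> = dot (i + k) (cut i f) \<sigma>"
proof (induction i arbitrary: f \<sigma>)
  case 0
  have "cut 0 f = (\<lambda>\<tau>. f (z # \<tau>))" by (simp add: fun_eq_iff)
  then show ?case by simp
next
  case (Suc i)
  then show ?case by (cases \<sigma>) auto
qed

lemma cut_dot_below: "cut (j + k + 1) (dot j f) \<sigma> = dot j (cut (j + k) f) \<sigma>"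
proof (induction j arbitrary: f \<sigma>)
  case 0
  show ?case by (cases \<sigma>) (auto simp: cut_zero)
next
  case (Suc j)
  then show ?case by (cases \<sigma>) auto
qed


text \<open>Each clause of \<open>cutw\<close> is one of the relations above; the value
  \<open>None\<close> arises only when the cut reaches the bottom vector.\<close>

lemma cut_vec:
  assumes \<beta>: "\<And>i \<sigma>. walk s \<sigma> \<Longrightarrow> cut i \<beta> \<sigma> = 0"
  shows "wword r w \<Longrightarrow> i < wsize r w \<Longrightarrow> walk s \<sigma> \<Longrightarrow> length \<sigma> + 1 = wsize r w \<Longrightarrow>
    cut i (vec s \<beta> w) \<sigma> = (case cutw i w of None \<Rightarrow> 0 | Some w' \<Rightarrow> vec s \<beta> w' \<sigma>)"
proof (induction w arbitrary: i \<sigma>)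
  case Nil
  then show ?case by (simp add: \<beta>)
next
  case (Cons p w)
  show ?case
  proof (cases p)
    case (Cup j)
    consider k where "j = i + k + 1" | "i = j" | "i = Suc j" | k where "i = j + k + 2"
      by (metis add.commute add_2_eq_Suc less_imp_Suc_add linorder_neqE_nat
          not_less_eq plus_1_eq_Suc add.assoc add_Suc_right Suc_lessI)
    then show ?thesis
    proof cases
      case (1 k)
      have "cut i (vec s \<beta> (p # w)) \<sigma> = cup s (i + k) (cut i (vec s \<beta> w)) \<sigma>"
        by (simp only: Cup 1 vec.simps cut_cup_above)
      also have "\<dots> = cup s (i + k)
          (\<lambda>\<tau>. case cutw i w of None \<Rightarrow> 0 | Some w' \<Rightarrow> vec s \<beta> w' \<tau>) \<sigma>"
        by (rule cup_cong) (use Cons Cup 1 in auto)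
      finally show ?thesis using Cup 1 by (auto simp: cup_zero split: option.splits)
    next
      case 2
      then show ?thesis using Cons.prems Cup by (simp add: cut_cup_same)
    next
      case 3
      then show ?thesis using Cons.prems Cup by (simp add: cut_cup_right)
    next
      case (4 k)
      have "cut i (vec s \<beta> (p # w)) \<sigma> = cup s j (cut (j + k) (vec s \<beta> w)) \<sigma>"
        by (simp only: Cup 4 vec.simps cut_cup_below)
      also have "\<dots> = cup s j
          (\<lambda>\<tau>. case cutw (j + k) w of None \<Rightarrow> 0 | Some w' \<Rightarrow> vec s \<beta> w' \<tau>) \<sigma>"
        by (rule cup_cong) (use Cons Cup 4 in auto)
      finally show ?thesis using Cup 4 by (auto simp: cup_zero split: option.splits)
    qed
  next
    case (Dot j)
    consider k where "j = i + k + 1" | "i = j" | k where "i = j + k + 1"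
      by (metis Suc_eq_plus1 less_imp_Suc_add linorder_neqE_nat)
    then show ?thesis
    proof cases
      case (1 k)
      have "cut i (vec s \<beta> (p # w)) \<sigma> = dot (i + k) (cut i (vec s \<beta> w)) \<sigma>"
        by (simp only: Dot 1 vec.simps cut_dot_above)
      also have "\<dots> = dot (i + k)
          (\<lambda>\<tau>. case cutw i w of None \<Rightarrow> 0 | Some w' \<Rightarrow> vec s \<beta> w' \<tau>) \<sigma>"
        by (rule dot_cong[of s]) (use Cons Dot 1 in auto)
      finally show ?thesis using Dot 1 by (auto simp: dot_zero split: option.splits)
    next
      case 2
      then show ?thesis using Cons.prems Dot by (simp add: cut_dot_same)
    next
      case (3 k)
      have "cut i (vec s \<beta> (p # w)) \<sigma> = dot j (cut (j + k) (vec s \<beta> w)) \<sigma>"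
        by (simp only: Dot 3 vec.simps cut_dot_below)
      also have "\<dots> = dot j
          (\<lambda>\<tau>. case cutw (j + k) w of None \<Rightarrow> 0 | Some w' \<Rightarrow> vec s \<beta> w' \<tau>) \<sigma>"
        by (rule dot_cong[of s]) (use Cons Dot 3 in auto)
      finally show ?thesis using Dot 3 by (auto simp: dot_zero split: option.splits)
    qed
  qed
qed

lemma cap_vec:
  assumes \<beta>: "\<And>i \<sigma>. walk s \<sigma> \<Longrightarrow> cut i \<beta> \<sigma> = 0" "\<And>i \<sigma>. walk s \<sigma> \<Longrightarrow> cap s i \<beta> \<sigma> = 0"
  shows "wword r w \<Longrightarrow> i + 2 \<le> wsize r w \<Longrightarrow> walk s \<sigma> \<Longrightarrow> length \<sigma> + 2 = wsize r w \<Longrightarrow>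
    cap s i (vec s \<beta> w) \<sigma> =
      (case capw i w of None \<Rightarrow> 0 | Some (n, w') \<Rightarrow> x ^ n * vec s \<beta> w' \<sigma>)"
proof (induction w arbitrary: i \<sigma>)
  case Nil
  then show ?case by (simp add: \<beta>)
next
  case (Cons p w)
  show ?case
  proof (cases p)
    case (Cup j)
    consider k where "j = i + k + 2" | "j = Suc i" | "i = j" | "i = Suc j" | k where "i = j + k + 2"
      by (metis add.commute add_2_eq_Suc less_imp_Suc_add linorder_neqE_nat
          not_less_eq plus_1_eq_Suc add.assoc add_Suc_right Suc_lessI)
    then show ?thesis
    proof cases
      case (1 k)
      have "cap s i (vec s \<beta> (p # w)) \<sigma> = cup s (i + k) (cap s i (vec s \<beta> w)) \<sigma>"
        by (simp only: Cup 1 vec.simps cap_cup_above)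
      also have "\<dots> = cup s (i + k)
          (\<lambda>\<tau>. case capw i w of None \<Rightarrow> 0 | Some (n, w') \<Rightarrow> x ^ n * vec s \<beta> w' \<tau>) \<sigma>"
        by (rule cup_cong) (use Cons Cup 1 in auto)
      finally show ?thesis using Cup 1 by (auto simp: cup_zero cup_scale split: option.splits)
    next
      case 2
      then show ?thesis using Cons.prems Cup by (simp add: cap_cup_right)
    next
      case 3
      then show ?thesis using Cons.prems Cup by (simp add: cap_cup_same)
    next
      case 4
      then show ?thesis using Cons.prems Cup by (simp add: cap_cup_left)
    next
      case (5 k)
      have "cap s i (vec s \<beta> (p # w)) \<sigma> = cup s j (cap s (j + k) (vec s \<beta> w)) \<sigma>"
        using Cons.prems by (simp only: Cup 5 vec.simps cap_cup_below)
      also have "\<dots> = cup s j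
          (\<lambda>\<tau>. case capw (j + k) w of None \<Rightarrow> 0 | Some (n, w') \<Rightarrow> x ^ n * vec s \<beta> w' \<tau>) \<sigma>"
        by (rule cup_cong) (use Cons Cup 5 in auto)
      finally show ?thesis using Cup 5 by (auto simp: cup_zero cup_scale split: option.splits)
    qed
  next
    case (Dot j)
    consider k where "j = i + k + 2" | "j = i \<or> j = Suc i" | k where "i = j + k + 1"
      by (metis add.commute add_2_eq_Suc less_imp_Suc_add linorder_neqE_nat
          not_less_eq plus_1_eq_Suc add.assoc add_Suc_right Suc_lessI)
    then show ?thesis
    proof cases
      case (1 k)
      have "cap s i (vec s \<beta> (p # w)) \<sigma> = dot (i + k) (cap s i (vec s \<beta> w)) \<sigma>"
        by (simp only: Dot 1 vec.simps cap_dot_above)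
      also have "\<dots> = dot (i + k)
          (\<lambda>\<tau>. case capw i w of None \<Rightarrow> 0 | Some (n, w') \<Rightarrow> x ^ n * vec s \<beta> w' \<tau>) \<sigma>"
        by (rule dot_cong[of s]) (use Cons Dot 1 in auto)
      finally show ?thesis using Dot 1 by (auto simp: dot_zero dot_scale split: option.splits)
    next
      case 2
      then have "cap s i (vec s \<beta> (p # w)) \<sigma> = cut i (vec s \<beta> w) \<sigma>"
        using Cons.prems Dot by (auto simp: cap_dot_same cap_dot_right)
      also have "\<dots> = (case cutw i w of None \<Rightarrow> 0 | Some w' \<Rightarrow> vec s \<beta> w' \<sigma>)"
        using Cons.prems Dot by (intro cut_vec[OF \<beta>(1)]) auto
      finally show ?thesis using Dot 2 by (auto split: option.splits)
    next
      case (3 k)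
      have "cap s i (vec s \<beta> (p # w)) \<sigma> = dot j (cap s (j + k) (vec s \<beta> w)) \<sigma>"
        by (simp only: Dot 3 vec.simps cap_dot_below)
      also have "\<dots> = dot j
          (\<lambda>\<tau>. case capw (j + k) w of None \<Rightarrow> 0 | Some (n, w') \<Rightarrow> x ^ n * vec s \<beta> w' \<tau>) \<sigma>"
        by (rule dot_cong[of s]) (use Cons Dot 3 in auto)
      finally show ?thesis using Dot 3 by (auto simp: dot_zero dot_scale split: option.splits)
    qed
  qed
qed

text \<open>The transposed letters of \<open>w\<close> are pushed into \<open>v\<close> one at a
  time. The model enters the result only through the loop value and the pairing of the two bottom
  vectors.\<close>

theorem bil_vec:
  assumes \<beta>': "\<And>i \<sigma>. walk s \<sigma> \<Longrightarrow> cut i \<beta>' \<sigma> = 0" "\<And>i \<sigma>. walk s \<sigma> \<Longrightarrow> cap s i \<beta>' \<sigma> = 0"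
  shows "wword r w \<Longrightarrow> wword r v \<Longrightarrow> wsize r w = wsize r v \<Longrightarrow>
    bil s (wsize r w) (vec s \<beta> w) (vec s \<beta>' v) =
      (case ev w v of None \<Rightarrow> 0 | Some n \<Rightarrow> x ^ n * bil s r \<beta> \<beta>')"
proof (induction w arbitrary: v)
  case Nil
  show ?case
  proof (cases v)
    case (Cons p u)
    \<comment> \<open>A remaining letter would make the row of \<open>v\<close> longer than the
      \<open>r\<close> points of the empty word.\<close>
    then show ?thesis using Nil wsize_ge[of r u] by (cases p) auto
  qed simp
next
  case (Cons p w)
  show ?case
  proof (cases p)
    case (Cup i)
    have "bil s (wsize r (p # w)) (vec s \<beta> (p # w)) (vec s \<beta>' v) =
        bil s (wsize r w) (vec s \<beta> w) (cap s i (vec s \<beta>' v))"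
      by (simp only: Cup wsize.simps vec.simps bil_cup)
    also have "\<dots> = bil s (wsize r w) (vec s \<beta> w)
        (\<lambda>\<tau>. case capw i v of None \<Rightarrow> 0 | Some (n, v') \<Rightarrow> x ^ n * vec s \<beta>' v' \<tau>)"
      by (rule bil_cong[OF refl cap_vec[OF \<beta>']]) (use Cons.prems Cup in auto)
    also have "\<dots> = (case ev (p # w) v of None \<Rightarrow> 0 | Some n \<Rightarrow> x ^ n * bil s r \<beta> \<beta>')"
    proof (cases "capw i v")
      case None
      then show ?thesis by (simp add: Cup bil_zero)
    next
      case (Some nv)
      obtain n v' where nv: "nv = (n, v')" by (cases nv)
      have "wword r v' \<and> wsize r v' + 2 = wsize r v"
        using Cons.prems Cup Some nv by (intro capw_wword[of i v n]) auto
      then show ?thesis using Cons.prems Cup Some nv Cons.IH[of v']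
        by (simp add: bil_scale power_add split: option.splits)
    qed
    finally show ?thesis .
  next
    case (Dot i)
    have "bil s (wsize r (p # w)) (vec s \<beta> (p # w)) (vec s \<beta>' v) =
        bil s (wsize r w) (vec s \<beta> w) (cut i (vec s \<beta>' v))"
      by (simp only: Dot wsize.simps vec.simps bil_dot)
    also have "\<dots> = bil s (wsize r w) (vec s \<beta> w)
        (\<lambda>\<tau>. case cutw i v of None \<Rightarrow> 0 | Some v' \<Rightarrow> vec s \<beta>' v' \<tau>)"
      by (rule bil_cong[OF refl cut_vec[OF \<beta>'(1)]]) (use Cons.prems Dot in auto)
    also have "\<dots> = (case ev (p # w) v of None \<Rightarrow> 0 | Some n \<Rightarrow> x ^ n * bil s r \<beta> \<beta>')"
    proof (cases "cutw i v")
      case None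
      then show ?thesis by (simp add: Dot bil_zero)
    next
      case (Some v')
      have "wword r v' \<and> wsize r v' + 1 = wsize r v"
        using Cons.prems Dot Some by (intro cutw_wword[of i v]) auto
      then show ?thesis using Cons.prems Dot Some Cons.IH[of v'] by simp
    qed
    finally show ?thesis .
  qed
qed


section \<open>Weights of walks, and bottom vectors supported on one word\<close>

fun wt :: "'s \<Rightarrow> 'a list \<Rightarrow> 'f" where
  "wt s [] = 1"
| "wt s (a # \<sigma>) = d s a * wt (nx s a) \<sigma>"

fun dest :: "'s \<Rightarrow> 'a list \<Rightarrow> 's" where
  "dest s [] = s"
| "dest s (a # \<sigma>) = dest (nx s a) \<sigma>"

lemma wt_append: "wt s (u @ v) = wt s u * wt (dest s u) v"
  by (induction s u rule: dest.induct) auto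

lemma walk_append: "walk s (u @ v) \<longleftrightarrow> walk s u \<and> walk (dest s u) v"
  by (induction s u rule: dest.induct) auto

lemma finite_walks: "finite {\<sigma>. walk s \<sigma> \<and> length \<sigma> = n}"
proof (induction n arbitrary: s)
  case 0
  have "{\<sigma>. walk s \<sigma> \<and> length \<sigma> = 0} = {[]}" by auto
  then show ?case by simp
next
  case (Suc n)
  have "{\<sigma>. walk s \<sigma> \<and> length \<sigma> = Suc n} \<subseteq>
      (\<Union>a\<in>A s. (#) a ` {\<sigma>. walk (nx s a) \<sigma> \<and> length \<sigma> = n})"
    by (auto simp: length_Suc_conv)
  then show ?case
    using finite_steps Suc by (auto intro: finite_subset)
qed

lemma bil_eq_sum:
  "bil s n f g = (\<Sum>\<sigma> | walk s \<sigma> \<and> length \<sigma> = n. wt s \<sigma> * f \<sigma> * g \<sigma>)"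
proof (induction n arbitrary: s f g)
  case 0
  have "{\<sigma>. walk s \<sigma> \<and> length \<sigma> = 0} = {[]}" by auto
  then show ?case by simp
next
  case (Suc n)
  let ?X = "\<lambda>a. {\<sigma>. walk (nx s a) \<sigma> \<and> length \<sigma> = n}"
  have "bil s (Suc n) f g =
      (\<Sum>a\<in>A s. \<Sum>\<sigma>\<in>?X a. wt s (a # \<sigma>) * f (a # \<sigma>) * g (a # \<sigma>))"
    by (simp add: Suc sum_distrib_left mult.assoc)
  also have "\<dots> = (\<Sum>(a, \<sigma>)\<in>Sigma (A s) ?X. wt s (a # \<sigma>) * f (a # \<sigma>) * g (a # \<sigma>))"
    by (rule sum.Sigma) (auto simp: finite_steps finite_walks)
  also have "\<dots> = (\<Sum>\<sigma> | walk s \<sigma> \<and> length \<sigma> = Suc n. wt s \<sigma> * f \<sigma> * g \<sigma>)"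
    by (rule sum.reindex_bij_witness[of _ "\<lambda>\<sigma>. (hd \<sigma>, tl \<sigma>)" "\<lambda>(a, \<sigma>). a # \<sigma>"])
      (auto simp: length_Suc_conv)
  finally show ?case .
qed

lemma cut_indicator:
  assumes "z \<notin> set \<beta>"
  shows "cut i (\<lambda>\<sigma>. if \<sigma> = \<beta> then 1 else 0) \<sigma> = 0"
  using assms
proof (induction i arbitrary: \<beta> \<sigma>)
  case (Suc i)
  show ?case
  proof (cases \<sigma>)
    case (Cons a \<tau>)
    have "(\<lambda>\<tau>. if a # \<tau> = \<beta> then 1 else (0::'f)) =
        (if \<beta> \<noteq> [] \<and> hd \<beta> = a then (\<lambda>\<tau>. if \<tau> = tl \<beta> then 1 else 0) else (\<lambda>\<tau>. 0))"
      by (cases \<beta>) (auto simp: fun_eq_iff)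
    then show ?thesis using Suc.IH[of "tl \<beta>" \<tau>] Suc.prems
      by (cases \<beta>) (auto simp: Cons cut_zero)
  qed simp
qed auto

text \<open>Neighbouring letters of such a word can never be joined. The assumption covers every
  state because the cap may sit after any initial part of a walk.\<close>

lemma cap_indicator:
  assumes "\<And>i s. Suc i < length \<beta> \<Longrightarrow> kw s (\<beta> ! i) (\<beta> ! Suc i) = 0"
  shows "cap s i (\<lambda>\<sigma>. if \<sigma> = \<beta> then 1 else 0) \<sigma> = 0"
  using assms
proof (induction i arbitrary: s \<beta> \<sigma>)
  case 0
  have "kw s a b * (if a # b # \<sigma> = \<beta> then 1 else 0) = 0" for a b
    using 0[of 0 s] by auto
  then show ?case by (simp only: cap.simps sum.neutral_const)
next
  case (Suc i)
  show ?case
  proof (cases \<sigma>)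
    case (Cons a \<tau>)
    have "(\<lambda>\<tau>. if a # \<tau> = \<beta> then 1 else (0::'f)) =
        (if \<beta> \<noteq> [] \<and> hd \<beta> = a then (\<lambda>\<tau>. if \<tau> = tl \<beta> then 1 else 0) else (\<lambda>\<tau>. 0))"
      by (cases \<beta>) (auto simp: fun_eq_iff)
    moreover have "cap (nx s a) i (\<lambda>\<sigma>. if \<sigma> = tl \<beta> then 1 else 0) \<tau> = 0"
    proof (rule Suc.IH)
      show "kw s' (tl \<beta> ! j) (tl \<beta> ! Suc j) = 0" if "Suc j < length (tl \<beta>)" for j s'
        using Suc.prems[of "Suc j" s'] that by (cases \<beta>) auto
    qed
    ultimately show ?thesis by (simp add: Cons cap_zero)
  qed simp
qed

lemma cup_append: "cup s (length u) f (u @ a # b # v) = cw (dest s u) a b * f (u @ v)"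
  by (induction u arbitrary: s f) auto

lemma dot_append: "dot (length u) f (u @ a # v) = (if a = z then f (u @ v) else 0)"
  by (induction u arbitrary: f) auto

end

section \<open>The path model\<close>

text \<open>
  \<open>word j p\<close> produces the one-factor of the path that starts with \<open>j\<close> up-steps and continues as \<open>p\<close>:
  the first down-step closes the up-step at (0-based) position \<open>j - 1\<close>.
\<close>

fun word :: "nat \<Rightarrow> int list \<Rightarrow> op list" where
  "word j [] = []"
| "word j (a # p) =
     (if a = 1 then word (Suc j) p
      else if a = 0 then Dot j # word j p
      else Cup (j - 1) # word (j - 1) p)"

definition msteps :: "nat \<Rightarrow> int set" where
  "msteps h = (if h = 0 then {0, 1} else {-1, 0, 1})"

definition mnext :: "nat \<Rightarrow> int \<Rightarrow> nat" where
  "mnext h a = nat (int h + a)"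

lemma mnext_simps [simp]: "mnext h 1 = Suc h" "mnext h 0 = h" "mnext h (-1) = h - 1"
  by (auto simp: mnext_def nat_diff_distrib)

lemma msteps_cases:
  assumes "a \<in> msteps j"
  obtains "a = 1" | "a = 0" | "a = -1" "j \<noteq> 0"
  using assms by (auto simp: msteps_def split: if_splits)

definition cheb_ratio :: "'f::field \<Rightarrow> nat \<Rightarrow> 'f" where
  "cheb_ratio y h = cheb_u (Suc h) y / cheb_u h y"

text \<open>
  With \<open>w h\<close> the ratio at height \<open>h\<close>, a loop inserted at height \<open>h\<close> has the value
  \<open>w h + 1 + 1 / w (h - 1)\<close>, which the Chebyshev recursion turns into \<open>y + 1\<close>.
\<close>

definition path_cw :: "'f::field \<Rightarrow> nat \<Rightarrow> int \<Rightarrow> int \<Rightarrow> 'f" where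
  "path_cw y h a b =
     (if a = 0 \<and> b = 0 \<or> a = 1 \<and> b = -1 then 1
      else if a = -1 \<and> b = 1 then inverse (cheb_ratio y (h - 1)) else 0)"

definition path_d :: "'f::field \<Rightarrow> nat \<Rightarrow> int \<Rightarrow> 'f" where
  "path_d y h a = (if a = -1 then cheb_ratio y (h - 1) else 1)"

definition path_kw :: "'f::field \<Rightarrow> nat \<Rightarrow> int \<Rightarrow> int \<Rightarrow> 'f" where
  "path_kw y h a b = path_d y h a * path_d y (mnext h a) b * path_cw y h a b"

locale path_model =
  fixes y :: "'f::field"
  assumes cheb_nonzero: "cheb_u n y \<noteq> 0"
begin

lemma ratio_nonzero: "cheb_ratio y h \<noteq> 0"
  by (simp add: cheb_ratio_def cheb_nonzero)

lemma ratio_rec: "cheb_ratio y (Suc h) + inverse (cheb_ratio y h) = y"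
  using cheb_nonzero[of "Suc h"] by (simp add: cheb_ratio_def field_simps)

sublocale cup_model msteps mnext 0 "path_cw y" "path_d y" "path_kw y" "y + 1"
proof
  fix s a b
  show "path_cw y s a b \<noteq> 0 \<Longrightarrow> a \<in> msteps s \<Longrightarrow> b \<in> msteps (mnext s a) \<Longrightarrow>
      mnext (mnext s a) b = s"
    by (auto simp: path_cw_def msteps_def mnext_def split: if_splits)
  show "(\<Sum>a\<in>msteps s. \<Sum>b\<in>msteps (mnext s a). path_kw y s a b * path_cw y s a b) = y + 1"
  proof (cases s)
    \<comment> \<open>At height 0 there is no down-step, so the term with an inverse ratio is
      absent, and the ratio itself is \<open>y\<close>.\<close>
    case 0
    then show ?thesis
      by (simp add: msteps_def mnext_def path_kw_def path_cw_def path_d_def cheb_ratio_def)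
  next
    case (Suc h)
    have "cheb_ratio y h \<noteq> 0" by (rule ratio_nonzero)
    then have "(\<Sum>a\<in>msteps s. \<Sum>b\<in>msteps (mnext s a). path_kw y s a b * path_cw y s a b) =
        cheb_ratio y (Suc h) + inverse (cheb_ratio y h) + 1"
      by (cases h) (simp_all add: Suc msteps_def mnext_def path_kw_def path_cw_def path_d_def
          nat_add_distrib)
    then show ?thesis using ratio_rec[of h] by simp
  qed
  fix c
  assume "b \<in> msteps s" "c \<in> msteps s"
  then show "(\<Sum>a\<in>msteps (mnext s c). path_kw y s c a * path_cw y (mnext s c) a b) =
      (if b = c then 1 else 0)"
    using ratio_nonzero[of s] ratio_nonzero[of "s - 1"]
    by (cases s; cases "s - 1")
      (auto simp: msteps_def mnext_def path_kw_def path_cw_def path_d_def nat_add_distrib)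
  show "(\<Sum>a\<in>msteps (mnext s b). path_cw y s b a * path_kw y (mnext s b) a c) =
      (if b = c then 1 else 0)"
    using ratio_nonzero[of s] ratio_nonzero[of "s - 1"] \<open>b \<in> msteps s\<close> \<open>c \<in> msteps s\<close>
    by (cases s; cases "s - 1")
      (auto simp: msteps_def mnext_def path_kw_def path_cw_def path_d_def nat_add_distrib)
qed (auto simp: msteps_def mnext_def path_kw_def path_cw_def path_d_def)


section \<open>Unitriangularity of the vectors of paths\<close>

lemma word_wword:
  "walk j p \<Longrightarrow> int j + sum_list p = int r \<Longrightarrow>
    wword r (word j p) \<and> wsize r (word j p) = j + length p"
proof (induction p arbitrary: j)
  case (Cons a p)
  then have "a \<in> msteps j" "walk (mnext j a) p" by auto
  moreover from this have "int (mnext j a) + sum_list p = int r"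
    using Cons.prems by (auto simp: msteps_def mnext_def split: if_splits)
  ultimately show ?case
    using Cons.IH[of "mnext j a"] by (cases rule: msteps_cases[of a j]) auto
qed simp

definition base :: "nat \<Rightarrow> int list \<Rightarrow> 'f" where
  "base r = (\<lambda>\<sigma>. if \<sigma> = replicate r 1 then 1 else 0)"

lemma append_le_lex:
  fixes u u' :: "int list"
  assumes "length u = length u'"
  shows "u @ v \<le> u' @ v' \<longleftrightarrow> u < u' \<or> u = u' \<and> v \<le> v'"
  using assms by (induction u u' rule: list_induct2) auto

text \<open>Where the path has \<open>(1, -1)\<close>, a cup can insert \<open>(1, -1)\<close>,
  \<open>(0, 0)\<close> or \<open>(-1, 1)\<close>. The first is lexicographically greatest and all
  three have sum 0, so contributing sequences lie below the path and share its rank. The prefix of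
  ones represents the pending up-steps.\<close>

lemma vec_word_support:
  "walk j p \<Longrightarrow> int j + sum_list p = int r \<Longrightarrow> length \<sigma> = j + length p \<Longrightarrow>
    vec 0 (base r) (word j p) \<sigma> \<noteq> 0 \<Longrightarrow> \<sigma> \<le> replicate j 1 @ p \<and> sum_list \<sigma> = int r"
proof (induction p arbitrary: j \<sigma>)
  case Nil
  then show ?case by (auto simp: base_def sum_list_replicate split: if_splits)
next
  case (Cons a p)
  then have a: "a \<in> msteps j" and w: "walk (mnext j a) p" by auto
  have sum: "int (mnext j a) + sum_list p = int r"
    using Cons.prems a by (auto simp: msteps_def mnext_def split: if_splits)
  note IH = Cons.IH[OF w sum]
  from a show ?case
  proof (cases rule: msteps_cases)
    case 1
    then show ?thesis
      using IH[of \<sigma>] Cons.prems by (simp add: replicate_app_Cons_same)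
  next
    case 2
    obtain u c v where \<sigma>: "\<sigma> = u @ c # v" "length u = j"
      using Cons.prems(3) id_take_nth_drop[of j \<sigma>] by fastforce
    have "c = 0" and nz: "vec 0 (base r) (word j p) (u @ v) \<noteq> 0"
      using Cons.prems(4) dot_append[of u _ c v] \<sigma> 2 by (auto split: if_splits)
    then show ?thesis
      using IH[of "u @ v"] Cons.prems(3) \<sigma> 2 by (auto simp: append_le_lex)
  next
    case 3
    obtain u c v' where \<sigma>': "\<sigma> = u @ c # v'" "length u = j - 1"
      using Cons.prems(3) id_take_nth_drop[of "j - 1" \<sigma>] 3 by fastforce
    then obtain c' v where \<sigma>: "\<sigma> = u @ c # c' # v"
      using Cons.prems(3) 3 by (cases v') auto
    have "path_cw y (dest 0 u) c c' * vec 0 (base r) (word (j - 1) p) (u @ v) \<noteq> 0"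
      using Cons.prems(4) cup_append[of 0 u _ c c' v] \<sigma> \<sigma>'(2) 3 by simp
    then have nz: "vec 0 (base r) (word (j - 1) p) (u @ v) \<noteq> 0"
      and cc: "c = 0 \<and> c' = 0 \<or> c = 1 \<and> c' = -1 \<or> c = -1 \<and> c' = 1"
      by (auto simp: path_cw_def split: if_splits)
    have j: "mnext j a = j - 1" using 3 by simp
    have le: "u @ v \<le> replicate (j - 1) 1 @ p" "sum_list (u @ v) = int r"
      using IH[of "u @ v"] nz j Cons.prems(3) \<sigma> \<sigma>'(2) 3 by auto
    \<comment> \<open>The down-step and the last pending up-step are adjacent, exactly where
      \<open>Cup (j - 1)\<close> inserts its pair.\<close>
    have "replicate j 1 @ a # p = replicate (j - 1) 1 @ 1 # (-1) # p"
      using 3 by (cases j) (auto simp: replicate_app_Cons_same)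
    moreover have "\<sigma> \<le> replicate (j - 1) 1 @ 1 # (-1) # p"
      using le(1) cc unfolding \<sigma> by (auto simp: append_le_lex \<sigma>'(2))
    ultimately show ?thesis using le(2) cc by (auto simp: \<sigma>)
  qed
qed

text \<open>The path itself comes from choosing \<open>(1, -1)\<close> at every cup, and
  \<open>path_cw\<close> is normalised to be 1 there at every height.\<close>

lemma vec_word_self:
  "walk j p \<Longrightarrow> int j + sum_list p = int r \<Longrightarrow>
    vec 0 (base r) (word j p) (replicate j 1 @ p) = 1"
proof (induction p arbitrary: j)
  case Nil
  then show ?case by (simp add: base_def)
next
  case (Cons a p)
  then have a: "a \<in> msteps j" and w: "walk (mnext j a) p" by auto
  have sum: "int (mnext j a) + sum_list p = int r"
    using Cons.prems a by (auto simp: msteps_def mnext_def split: if_splits)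
  note IH = Cons.IH[OF w sum]
  from a show ?case
  proof (cases rule: msteps_cases)
    case 1
    then show ?thesis
      using IH by (simp add: replicate_app_Cons_same)
  next
    case 2
    then show ?thesis
      using IH dot_append[of "replicate j 1" "vec 0 (base r) (word j p)" 0 p]
      by simp
  next
    case 3
    have j: "mnext j a = j - 1" using 3 by simp
    have "replicate j 1 @ a # p = replicate (j - 1) 1 @ 1 # (-1) # p"
      using 3 by (cases j) (auto simp: replicate_app_Cons_same)
    moreover have "path_cw y h 1 (-1) = 1" for h by (simp add: path_cw_def)
    ultimately show ?thesis
      using IH 3 j cup_append[of 0 "replicate (j - 1) 1" "vec 0 (base r) (word (j - 1) p)" 1 "-1" p]
      by simp
  qed
qed

section \<open>The Gram matrix in the path model\<close>

lemma walk_iff: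
  "walk h \<sigma> \<longleftrightarrow> set \<sigma> \<subseteq> {-1, 0, 1} \<and> (\<forall>i\<le>length \<sigma>. int h + sum_list (take i \<sigma>) \<ge> 0)"
proof (induction \<sigma> arbitrary: h)
  case (Cons a \<sigma>)
  have all: "(\<forall>i\<le>length (a # \<sigma>). int h + sum_list (take i (a # \<sigma>)) \<ge> 0) \<longleftrightarrow>
      (\<forall>i\<le>length \<sigma>. int h + a + sum_list (take i \<sigma>) \<ge> 0)" (is "?L \<longleftrightarrow> ?R")
  proof
    assume ?L
    show ?R
    proof (intro allI impI)
      fix i assume "i \<le> length \<sigma>"
      then show "int h + a + sum_list (take i \<sigma>) \<ge> 0"
        using \<open>?L\<close>[rule_format, of "Suc i"] by simp
    qed
  next
    assume ?R
    show ?L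
    proof (intro allI impI)
      fix i assume "i \<le> length (a # \<sigma>)"
      then show "int h + sum_list (take i (a # \<sigma>)) \<ge> 0"
        using \<open>?R\<close>[rule_format, of "i - 1"] by (cases i) auto
    qed
  qed
  show ?case
  proof (cases "a \<in> {-1, 0, 1} \<and> int h + a \<ge> 0")
    case True
    then have "a \<in> msteps h" "int (mnext h a) = int h + a"
      by (auto simp: msteps_def mnext_def)
    then show ?thesis using True by (simp only: all walk.simps Cons.IH) auto
  next
    case False
    then have "a \<notin> msteps h" by (auto simp: msteps_def split: if_splits)
    moreover have "int h + a \<ge> 0" if ?R
      using that[rule_format, of 0] by simp
    ultimately show ?thesis using False by (simp only: all walk.simps) auto
  qed
qed simp

lemma motzkin_paths_eq:
  "motzkin_paths k r = {\<sigma>. walk 0 \<sigma> \<and> length \<sigma> = k \<and> sum_list \<sigma> = int r}"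
  by (auto simp: motzkin_paths_def walk_iff)

lemma finite_motzkin_paths: "finite (motzkin_paths k r)"
  by (rule finite_subset[OF _ finite_walks[of 0 k]]) (auto simp: motzkin_paths_eq)

text \<open>The bottom word consists of up-steps: there is no flat step to cut, and two consecutive
  up-steps have coefficient 0 in \<open>path_kw\<close>.\<close>

lemma base_cap: "cap s i (base r) \<sigma> = 0" and base_cut: "cut i (base r) \<sigma> = 0"
  unfolding base_def
  by (rule cap_indicator, simp add: path_kw_def path_cw_def) (rule cut_indicator, simp)

lemma bil_base: "bil 0 r (base r) (base r) = 1"
proof -
  have rep: "walk s (replicate n 1) \<and> wt s (replicate n 1) = 1" for s n
    by (induction n arbitrary: s) (auto simp: msteps_def path_d_def)
  have "bil 0 r (base r) (base r) =
      (\<Sum>\<sigma> | walk 0 \<sigma> \<and> length \<sigma> = r. if \<sigma> = replicate r 1 then 1 else 0)"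
    unfolding bil_eq_sum base_def by (intro sum.cong) (auto simp: rep)
  then show ?thesis by (simp add: finite_walks rep)
qed

lemma bil_word:
  assumes "p \<in> motzkin_paths k r" "q \<in> motzkin_paths k r"
  shows "bil 0 k (vec 0 (base r) (word 0 p)) (vec 0 (base r) (word 0 q)) =
    (case ev (word 0 p) (word 0 q) of None \<Rightarrow> 0 | Some n \<Rightarrow> (y + 1) ^ n)"
  using bil_vec[where s = 0 and \<beta> = "base r" and \<beta>' = "base r" and r = r and w = "word 0 p" and v = "word 0 q"]
    assms word_wword[of 0 p r] word_wword[of 0 q r]
  by (simp add: base_cap base_cut bil_base motzkin_paths_eq cong: option.case_cong)

theorem det_path_gram:
  assumes "\<And>p q. p \<in> motzkin_paths k r \<Longrightarrow> q \<in> motzkin_paths k r \<Longrightarrow>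
    M p q = (case ev (word 0 p) (word 0 q) of None \<Rightarrow> 0 | Some n \<Rightarrow> (y + 1) ^ n)"
  shows "det_on (motzkin_paths k r) M = (\<Prod>\<sigma>\<in>motzkin_paths k r. wt 0 \<sigma>)"
proof (rule det_on_LDL[where V = "\<lambda>p. vec 0 (base r) (word 0 p)"])
  fix p assume p: "p \<in> motzkin_paths k r"
  show "vec 0 (base r) (word 0 p) p = 1"
    using p vec_word_self[of 0 p r] by (simp add: motzkin_paths_eq)
  fix q assume q: "q \<in> motzkin_paths k r"
  show "vec 0 (base r) (word 0 p) q \<noteq> 0 \<Longrightarrow> q \<le> p"
    using p q vec_word_support[of 0 p r q] by (simp add: motzkin_paths_eq)
  have "M p q = bil 0 k (vec 0 (base r) (word 0 p)) (vec 0 (base r) (word 0 q))"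
    using p q assms by (simp add: bil_word)
  also have "\<dots> = (\<Sum>\<sigma>\<in>motzkin_paths k r.
      wt 0 \<sigma> * vec 0 (base r) (word 0 p) \<sigma> * vec 0 (base r) (word 0 q) \<sigma>)"
    unfolding bil_eq_sum
  \<comment> \<open>The form runs over all walks of length \<open>k\<close>, but the vector of a
    path of rank \<open>r\<close> vanishes at walks of any other rank.\<close>
  proof (rule sum.mono_neutral_right[OF finite_walks])
    show "motzkin_paths k r \<subseteq> {\<sigma>. walk 0 \<sigma> \<and> length \<sigma> = k}" by (auto simp: motzkin_paths_eq)
    show "\<forall>\<sigma>\<in>{\<sigma>. walk 0 \<sigma> \<and> length \<sigma> = k} - motzkin_paths k r.
        wt 0 \<sigma> * vec 0 (base r) (word 0 p) \<sigma> * vec 0 (base r) (word 0 q) \<sigma> = 0"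
      using p vec_word_support[of 0 p r] by (auto simp: motzkin_paths_eq)
  qed
  finally show "M p q = (\<Sum>\<sigma>\<in>motzkin_paths k r.
      wt 0 \<sigma> * vec 0 (base r) (word 0 p) \<sigma> * vec 0 (base r) (word 0 q) \<sigma>)" .
qed (rule finite_motzkin_paths)

end

section \<open>The product of the step weights\<close>

context path_model
begin

lemma dest_eq: "walk h u \<Longrightarrow> int (dest h u) = int h + sum_list u"
proof (induction u arbitrary: h)
  case (Cons a u)
  then have "a \<in> msteps h" "walk (mnext h a) u" by auto
  then show ?case using Cons.IH[of "mnext h a"] by (cases rule: msteps_cases) auto
qed simp

text \<open>Paths are split by their last step because the weight of a down-step depends on its
  height, which for the last step is determined by \<open>r\<close>.\<close>

lemma motzkin_paths_Suc:
  "motzkin_paths (Suc k) r =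
    (if r = 0 then {} else (\<lambda>u. u @ [1]) ` motzkin_paths k (r - 1)) \<union>
    ((\<lambda>u. u @ [0]) ` motzkin_paths k r \<union> (\<lambda>u. u @ [-1]) ` motzkin_paths k (Suc r))"
  (is "?L = ?R1 \<union> (?R2 \<union> ?R3)")
proof (intro equalityI subsetI)
  fix p assume p: "p \<in> ?L"
  then obtain u a where ua: "p = u @ [a]"
    by (cases p rule: rev_cases) (auto simp: motzkin_paths_eq)
  with p have u: "walk 0 u" "a \<in> msteps (dest 0 u)" "length u = k" "sum_list u + a = int r"
    by (auto simp: motzkin_paths_eq walk_append)
  have e: "int (dest 0 u) = sum_list u" using dest_eq[OF u(1)] by simp
  from u(2) show "p \<in> ?R1 \<union> (?R2 \<union> ?R3)"
  proof (cases rule: msteps_cases)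
    case 1
    then have "r \<noteq> 0" "u \<in> motzkin_paths k (r - 1)"
      using u e by (auto simp: motzkin_paths_eq)
    then show ?thesis using ua 1 by auto
  next
    case 2
    then have "u \<in> motzkin_paths k r" using u by (auto simp: motzkin_paths_eq)
    then show ?thesis using ua 2 by auto
  next
    case 3
    then have "u \<in> motzkin_paths k (Suc r)" using u by (auto simp: motzkin_paths_eq)
    then show ?thesis using ua 3 by auto
  qed
next
  fix p assume "p \<in> ?R1 \<union> (?R2 \<union> ?R3)"
  moreover have "u @ [a] \<in> ?L"
    if "walk 0 u" "length u = k" "sum_list u + a = int r" "a \<in> {-1, 0, 1}" for u a
    using that dest_eq[of 0 u] by (auto simp: motzkin_paths_eq walk_append msteps_def)
  ultimately show "p \<in> ?L"
    by (auto simp: motzkin_paths_eq[of k] split: if_splits)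
qed

lemma prod_motzkin_paths_Suc:
  "(\<Prod>p\<in>motzkin_paths (Suc k) r. g p) =
    (if r = 0 then 1 else \<Prod>u\<in>motzkin_paths k (r - 1). g (u @ [1])) *
    (\<Prod>u\<in>motzkin_paths k r. g (u @ [0])) * (\<Prod>u\<in>motzkin_paths k (Suc r). g (u @ [-1]))"
  unfolding motzkin_paths_Suc
  by (subst prod.union_disjoint, simp_all add: finite_motzkin_paths, force)+
    (simp_all add: prod.reindex inj_on_def mult.assoc)

lemma motz_m_Suc:
  "motz_m (Suc k) r = (if r = 0 then 0 else motz_m k (r - 1)) + motz_m k r + motz_m k (Suc r)"
  unfolding motz_m_def motzkin_paths_Suc
  by (subst card_Un_disjoint, simp_all add: finite_motzkin_paths, force)+
    (simp_all add: card_image inj_on_def)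

lemma motzkin_paths_0: "motzkin_paths 0 r = (if r = 0 then {[]} else {})"
  by (auto simp: motzkin_paths_eq)

lemma motz_m_0: "motz_m 0 r = (if r = 0 then 1 else 0)"
  by (simp add: motz_m_def motzkin_paths_0)

lemma motz_m_large: "k < r \<Longrightarrow> motz_m k r = 0"
  by (induction k arbitrary: r) (auto simp: motz_m_0 motz_m_Suc)

lemma motz_m_self: "motz_m k k = 1"
  by (induction k) (auto simp: motz_m_0 motz_m_Suc motz_m_large)

lemma motz_m_pred: "motz_m (Suc k) k = Suc k"
  by (induction k) (auto simp: motz_m_0 motz_m_Suc[of "Suc _"] motz_m_large motz_m_self motz_m_Suc[of 0])

lemma prod_wt_Suc:
  "(\<Prod>p\<in>motzkin_paths (Suc k) r. wt 0 p) =
    (if r = 0 then 1 else \<Prod>p\<in>motzkin_paths k (r - 1). wt 0 p) *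
    (\<Prod>p\<in>motzkin_paths k r. wt 0 p) *
    ((\<Prod>p\<in>motzkin_paths k (Suc r). wt 0 p) * cheb_ratio y r ^ motz_m k (Suc r))"
proof -
  have "wt 0 (u @ [-1]) = wt 0 u * cheb_ratio y r" if "u \<in> motzkin_paths k (Suc r)" for u
  proof -
    have "dest 0 u = Suc r" using that dest_eq[of 0 u] by (auto simp: motzkin_paths_eq)
    then show ?thesis by (simp add: wt_append path_d_def)
  qed
  then have "(\<Prod>u\<in>motzkin_paths k (Suc r). wt 0 (u @ [-1])) =
      (\<Prod>p\<in>motzkin_paths k (Suc r). wt 0 p) * cheb_ratio y r ^ motz_m k (Suc r)"
    by (simp add: prod.distrib motz_m_def cong: prod.cong)
  then show ?thesis
    unfolding prod_motzkin_paths_Suc by (simp add: wt_append path_d_def)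
qed

text \<open>For 1 < s <= K the factors with exponent \<open>a s\<close> agree after an exchange of
  numerators: u_(s+r-1) / u_(s-1) times u_(s+r) / u_(s-2) equals u_(s+r) / u_(s-1) times u_(s+r-1) /
  u_(s-2). The two ratios outside the products are the boundary terms.\<close>

lemma telescoping_product:
  "(\<Prod>s = 1..K. (cheb_u (s + r - 1) y / cheb_u (s - 1) y) ^ a s *
       (cheb_u (s + r + 1) y / cheb_u (s - 1) y) ^ a (Suc s)) * cheb_ratio y r ^ a 1 =
   (\<Prod>s = 1..K. (cheb_u (s + r) y / cheb_u (s - 1) y) ^ (a s + a (Suc s))) *
     cheb_ratio y (K + r) ^ a (Suc K)"
proof (induction K)
  case (Suc K)
  let ?P = "\<lambda>K. \<Prod>s = 1..K. (cheb_u (s + r - 1) y / cheb_u (s - 1) y) ^ a s *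
       (cheb_u (s + r + 1) y / cheb_u (s - 1) y) ^ a (Suc s)"
  let ?Q = "\<lambda>K. \<Prod>s = 1..K. (cheb_u (s + r) y / cheb_u (s - 1) y) ^ (a s + a (Suc s))"
  have "?P (Suc K) * cheb_ratio y r ^ a 1 = (?P K * cheb_ratio y r ^ a 1) *
      ((cheb_u (K + r) y / cheb_u K y) ^ a (Suc K) *
       (cheb_u (K + r + 2) y / cheb_u K y) ^ a (Suc (Suc K)))"
    by (simp del: cheb_u.simps)
  also have "\<dots> = ?Q K * (cheb_ratio y (K + r) ^ a (Suc K) *
      ((cheb_u (K + r) y / cheb_u K y) ^ a (Suc K) *
       (cheb_u (K + r + 2) y / cheb_u K y) ^ a (Suc (Suc K))))"
    unfolding Suc.IH by (simp only: mult.assoc)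
  also have "\<dots> = ?Q K * ((cheb_u (Suc K + r) y / cheb_u K y) ^ (a (Suc K) + a (Suc (Suc K))) *
      cheb_ratio y (Suc K + r) ^ a (Suc (Suc K)))"
    by (simp add: cheb_ratio_def power_divide power_add cheb_nonzero divide_simps del: cheb_u.simps)
  also have "\<dots> = ?Q (Suc K) * cheb_ratio y (Suc K + r) ^ a (Suc (Suc K))"
    by (simp del: cheb_u.simps)
  finally show ?case .
qed simp

text \<open>\<open>K\<close> stays free so that the ranks \<open>r - 1\<close>, \<open>r\<close> and
  \<open>r + 1\<close> can share one range of \<open>s\<close> in the induction. Factors with
  \<open>r + 2 * s > k\<close> have exponent 0.\<close>

theorem prod_wt:
  assumes "k \<le> r + 2 * K + 1"
  shows "(\<Prod>p\<in>motzkin_paths k r. wt 0 p) =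
    (\<Prod>s = 1..K. (cheb_u (s + r) y / cheb_u (s - 1) y) ^ motz_m k (r + 2 * s))"
  using assms
proof (induction k arbitrary: r)
  case 0
  then show ?case by (auto simp: motzkin_paths_0 motz_m_0 intro!: prod.neutral)
next
  case (Suc k)
  let ?c = "\<lambda>r s. cheb_u (s + r) y / cheb_u (s - 1) y"
  define a where "a s = motz_m k (r + 2 * s - 1)" for s
  have a: "a (Suc s) = motz_m k (Suc r + 2 * s)" for s by (simp add: a_def)
  \<comment> \<open>This removes the upper boundary term of the telescoping; the rank
    \<open>r + 2 * K + 1\<close> exceeds the length \<open>k\<close>.\<close>
  have top: "a (Suc K) = 0" using Suc.prems by (simp add: a motz_m_large)
  have low: "(if r = 0 then 1 else \<Prod>p\<in>motzkin_paths k (r - 1). wt 0 p) =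
      (\<Prod>s = 1..K. (cheb_u (s + r - 1) y / cheb_u (s - 1) y) ^ a s)"
  proof (cases "r = 0")
    case True
    \<comment> \<open>For \<open>r = 0\<close> numerators and denominators coincide, so the general
      product also gives the value 1 of the missing case.\<close>
    then show ?thesis by (simp add: cheb_nonzero)
  next
    case False
    then show ?thesis
      using Suc.prems by (simp add: Suc.IH a_def)
  qed
  have high: "(\<Prod>p\<in>motzkin_paths k (Suc r). wt 0 p) =
      (\<Prod>s = 1..K. (cheb_u (s + r + 1) y / cheb_u (s - 1) y) ^ a (Suc s))"
    using Suc.prems by (simp add: Suc.IH a del: cheb_u.simps)
  have "(\<Prod>p\<in>motzkin_paths (Suc k) r. wt 0 p) =
      ((\<Prod>s = 1..K. (cheb_u (s + r - 1) y / cheb_u (s - 1) y) ^ a s *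
        (cheb_u (s + r + 1) y / cheb_u (s - 1) y) ^ a (Suc s)) * cheb_ratio y r ^ a 1) *
      (\<Prod>s = 1..K. ?c r s ^ motz_m k (r + 2 * s))"
    unfolding prod_wt_Suc low high prod.distrib
    using Suc.prems by (simp add: Suc.IH a_def ac_simps del: cheb_u.simps)
  also have "\<dots> = (\<Prod>s = 1..K. ?c r s ^ (a s + a (Suc s)) * ?c r s ^ motz_m k (r + 2 * s))"
    unfolding telescoping_product by (simp add: top prod.distrib)
  also have "\<dots> = (\<Prod>s = 1..K. ?c r s ^ motz_m (Suc k) (r + 2 * s))"
    by (intro prod.cong) (auto simp: motz_m_Suc a_def power_add[symmetric] ac_simps simp del: cheb_u.simps)
  finally show ?case .
qed

end

lemma cheb_u_two: "cheb_u n (2::'a::comm_ring_1) = of_nat (Suc n)"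
  by (induction n "2::'a" rule: cheb_u.induct) (auto simp: algebra_simps)

lemma poly_cheb_u: "poly (cheb_u n p) t = cheb_u n (poly p t)"
  by (induction n p rule: cheb_u.induct) auto

lemma cheb_u_Fract: "cheb_u n (Fract p 1) = Fract (cheb_u n p) 1"
  by (induction n p rule: cheb_u.induct) (auto simp: One_fract_def)

text \<open>Setting x = 3 makes the argument 2, where u_n has the value n + 1; a polynomial with a
  nonzero value is nonzero.\<close>

lemma cheb_u_xf_nonzero: "cheb_u n (xf - 1) \<noteq> 0"
proof -
  have "poly (cheb_u n [:-1, 1:]) 3 = (of_nat (Suc n) :: rat)"
    by (simp only: poly_cheb_u) (simp add: cheb_u_two del: of_nat_Suc)
  then have "cheb_u n [:-1, 1:] \<noteq> (0 :: rat poly)"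
    by (metis of_nat_neq_0 poly_0)
  moreover have "xf - 1 = Fract [:-1, 1:] 1"
    by (simp add: xf_def One_fract_def one_pCons)
  ultimately show ?thesis by (simp add: cheb_u_Fract Zero_fract_def eq_fract)
qed

section \<open>Pairings and white vertices of path prefixes\<close>

interpretation path: path_model "xf - 1"
  by unfold_locales (rule cheb_u_xf_nonzero)

lemma stp_append: "1 \<le> i \<Longrightarrow> i \<le> length u \<Longrightarrow> stp (u @ v) i = stp u i"
  by (cases i) (simp_all add: stp_def nth_append)

lemma stp_snoc: "stp (u @ [a]) (Suc (length u)) = a"
  by (simp add: stp_def)

lemma segsum_append: "1 \<le> i \<Longrightarrow> j \<le> length u \<Longrightarrow> segsum (u @ v) i j = segsum u i j"
  unfolding segsum_def by (intro sum.cong) (auto simp: stp_append)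

lemma segsum_snoc:
  "1 \<le> i \<Longrightarrow> i \<le> Suc (length u) \<Longrightarrow>
    segsum (u @ [a]) i (Suc (length u)) = segsum u i (length u) + a"
  using segsum_append[of i "length u" u "[a]"]
  by (simp add: segsum_def stp_snoc sum.nat_ivl_Suc')

lemma paired_snoc_old: "j \<le> length u \<Longrightarrow> paired (u @ [a]) i j \<longleftrightarrow> paired u i j"
  by (auto simp: paired_def stp_append segsum_append)

lemma paired_snoc_new:
  "paired (u @ [a]) i (Suc (length u)) \<longleftrightarrow> white u i \<and> segsum u i (length u) + a = 0"
proof
  assume "paired (u @ [a]) i (Suc (length u))"
  then show "white u i \<and> segsum u i (length u) + a = 0"
    by (auto simp: paired_def white_def stp_append segsum_append segsum_snoc)
next
  assume *: "white u i \<and> segsum u i (length u) + a = 0"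
  then have i: "1 \<le> i" "i \<le> length u" "stp u i = 1" "\<And>j. \<not> paired u i j" by (auto simp: white_def)
  \<comment> \<open>The least index at which the sum vanishes would be a partner of \<open>i\<close>
    in \<open>u\<close>, against whiteness.\<close>
  have nz: "segsum u i j \<noteq> 0" if "i < j" "j \<le> length u" for j
    using that
  proof (induction j rule: less_induct)
    case (less j)
    show ?case
    proof
      assume "segsum u i j = 0"
      then have "paired u i j" using less i by (auto simp: paired_def)
      then show False using i by blast
    qed
  qed
  show "paired (u @ [a]) i (Suc (length u))"
    using i * nz by (auto simp: paired_def stp_append segsum_append segsum_snoc)
qed

lemma paired_bound: "paired p i j \<Longrightarrow> 1 \<le> i \<and> i < j \<and> j \<le> length p"
  by (simp add: paired_def)

lemma white_snoc:
  "white (u @ [a]) i \<longleftrightarrow>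
    i = Suc (length u) \<and> a = 1 \<or> white u i \<and> segsum u i (length u) + a \<noteq> 0"
proof (cases "i = Suc (length u)")
  case True
  then show ?thesis using paired_bound[of "u @ [a]" i] by (force simp: white_def stp_snoc)
next
  case False
  show ?thesis
  proof (cases "1 \<le> i \<and> i \<le> length u")
    case True
    have "(\<exists>j. paired (u @ [a]) i j) \<longleftrightarrow>
        (\<exists>j. paired u i j) \<or> paired (u @ [a]) i (Suc (length u))"
      using paired_bound[of "u @ [a]" i] paired_bound[of u i]
      by (metis le_Suc_eq length_append_singleton paired_snoc_old)
    then show ?thesis
      using True paired_snoc_new[of u a i] by (auto simp: white_def stp_append)
  next
    case out: False
    then show ?thesis using False by (auto simp: white_def)
  qed
qed

lemma set_whites: "set (whites p) = {i. white p i}"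
  by (auto simp: whites_def white_def)

lemma distinct_whites: "distinct (whites p)"
  by (simp add: whites_def)

lemma whites_snoc:
  "whites (u @ [a]) =
    filter (\<lambda>i. segsum u i (length u) + a \<noteq> 0) (whites u) @ (if a = 1 then [Suc (length u)] else [])"
proof -
  have "filter (white (u @ [a])) [1..<Suc (length u)] =
      filter (\<lambda>i. segsum u i (length u) + a \<noteq> 0) (whites u)"
    unfolding whites_def filter_filter by (intro filter_cong) (auto simp: white_snoc)
  then show ?thesis
    using white_snoc[of u a "Suc (length u)"]
    by (auto simp: whites_def[of "u @ [a]"] white_def)
qed

text \<open>The white vertices of a prefix are its pending up-steps, one for each level from left to
  right. Only the last has segment sum 1, so only the last can be closed by a down-step.\<close>

lemma whites_heights:
  "path.walk 0 u \<Longrightarrow> int (length (whites u)) = sum_list u \<and>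
    (\<forall>t<length (whites u). segsum u (whites u ! t) (length u) = int (length (whites u) - t))"
proof (induction u rule: rev_induct)
  case Nil
  then show ?case by (simp add: whites_def)
next
  case (snoc a u)
  then have w: "path.walk 0 u" and a: "a \<in> msteps (path.dest 0 u)"
    by (auto simp: path.walk_append)
  let ?W = "whites u"
  have len: "int (length ?W) = sum_list u"
    and seg: "\<And>t. t < length ?W \<Longrightarrow> segsum u (?W ! t) (length u) = int (length ?W - t)"
    using snoc.IH w by auto
  have bnd: "1 \<le> i" "i \<le> length u" if "i \<in> set ?W" for i
    using that by (auto simp: set_whites white_def)
  have pos: "segsum u i (length u) \<ge> 1" if "i \<in> set ?W" for i
    using that seg by (auto simp: in_set_conv_nth)
  have segs: "segsum (u @ [a]) i (Suc (length u)) = segsum u i (length u) + a" if "i \<in> set ?W" for i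
    using bnd[OF that] by (intro segsum_snoc) auto
  from a show ?case
  proof (cases rule: msteps_cases)
    case 1
    have W: "whites (u @ [a]) = ?W @ [Suc (length u)]"
      using pos by (subst whites_snoc) (force simp: 1 intro!: filter_True)
    show ?thesis
    proof (intro conjI allI impI)
      fix t assume "t < length (whites (u @ [a]))"
      then consider "t < length ?W" | "t = length ?W" using W by fastforce
      then show "segsum (u @ [a]) (whites (u @ [a]) ! t) (length (u @ [a])) =
          int (length (whites (u @ [a])) - t)"
      proof cases
        case tl: 1
        then show ?thesis using seg[OF tl] segs[of "?W ! t"] 1 unfolding W by (simp add: nth_append)
      next
        case 2
        then show ?thesis using segsum_snoc[of "Suc (length u)" u a] 1
          unfolding W by (simp add: nth_append segsum_def)
      qed
    qed (use W len 1 in simp)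
  next
    case 2
    have W: "whites (u @ [a]) = ?W"
      using pos by (subst whites_snoc) (force simp: 2 intro!: filter_True)
    then show ?thesis using len seg segs 2 by simp
  next
    case 3
    have ne: "?W \<noteq> []"
      using len 3 path.dest_eq[OF w] by auto
    then obtain W' l where Wl: "?W = W' @ [l]" by (metis rev_exhaust)
    have l: "segsum u l (length u) = 1" using seg[of "length W'"] by (simp add: Wl)
    have W'2: "segsum u (W' ! t) (length u) = int (Suc (length W') - t)" if "t < length W'" for t
      using seg[of t] that by (simp add: Wl nth_append)
    have "filter (\<lambda>i. segsum u i (length u) + a \<noteq> 0) W' = W'"
    proof (rule filter_True, rule ballI)
      fix i assume "i \<in> set W'"
      then obtain t where "t < length W'" "i = W' ! t" by (auto simp: in_set_conv_nth)
      then show "segsum u i (length u) + a \<noteq> 0" using W'2[of t] 3 by simp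
    qed
    then have W: "whites (u @ [a]) = W'"
      by (subst whites_snoc) (use l 3 Wl in simp)
    show ?thesis
    proof (intro conjI allI impI)
      fix t assume "t < length (whites (u @ [a]))"
      then have "t < length W'" using W by simp
      then show "segsum (u @ [a]) (whites (u @ [a]) ! t) (length (u @ [a])) =
          int (length (whites (u @ [a])) - t)"
        using W'2[of t] segs[of "W' ! t"] 3(1) Wl unfolding W by simp
    qed (use W len 3 Wl in simp)
  qed
qed

lemma length_whites: "p \<in> motzkin_paths k r \<Longrightarrow> length (whites p) = r"
  using whites_heights[of p] by (simp add: path.motzkin_paths_eq)

lemma segsum_white:
  assumes "path.walk 0 u" "white u i"
  shows "segsum u i (length u) \<ge> 1" "segsum u i (length u) = 1 \<longleftrightarrow> i = last (whites u)"
proof -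
  let ?W = "whites u"
  obtain t where t: "t < length ?W" "i = ?W ! t"
    using assms(2) by (metis in_set_conv_nth mem_Collect_eq set_whites)
  have s: "segsum u i (length u) = int (length ?W - t)" using whites_heights[OF assms(1)] t by blast
  then show "segsum u i (length u) \<ge> 1" using t by simp
  have "segsum u i (length u) = 1 \<longleftrightarrow> t = length ?W - 1" using s t by auto
  also have "\<dots> \<longleftrightarrow> i = last ?W"
    using t distinct_whites[of u]
    by (cases "whites u = []") (auto simp: last_conv_nth nth_eq_iff_index_eq)
  finally show "segsum u i (length u) = 1 \<longleftrightarrow> i = last ?W" .
qed

text \<open>The white vertices of a growing prefix form a stack: an up-step pushes and a down-step
  pops.\<close>

lemma whites_snoc_walk:
  assumes "path.walk 0 (u @ [a])"
  shows "a = 1 \<Longrightarrow> whites (u @ [a]) = whites u @ [Suc (length u)]"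
    and "a = 0 \<Longrightarrow> whites (u @ [a]) = whites u"
    and "a = -1 \<Longrightarrow> whites u \<noteq> []"
    and "a = -1 \<Longrightarrow> whites (u @ [a]) = butlast (whites u)"
proof -
  have w: "path.walk 0 u" and a: "a \<in> msteps (path.dest 0 u)"
    using assms by (auto simp: path.walk_append)
  have wh: "white u i" if "i \<in> set (whites u)" for i using that by (simp add: set_whites)
  show "a = 1 \<Longrightarrow> whites (u @ [a]) = whites u @ [Suc (length u)]"
    using segsum_white(1)[OF w wh] by (subst whites_snoc) (force intro!: filter_True)
  show "a = 0 \<Longrightarrow> whites (u @ [a]) = whites u"
    using segsum_white(1)[OF w wh] by (subst whites_snoc) (force intro!: filter_True)
  assume a1: "a = -1"
  have "int (length (whites u)) = int (path.dest 0 u)"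
    using whites_heights[OF w] path.dest_eq[OF w] by simp
  then show ne: "whites u \<noteq> []" using a a1 by (auto simp: msteps_def split: if_splits)
  then obtain W' l where Wl: "whites u = W' @ [l]" by (metis rev_exhaust)
  have "filter (\<lambda>i. segsum u i (length u) + a \<noteq> 0) (whites u) = filter (\<lambda>i. i \<noteq> l) (whites u)"
    using segsum_white(2)[OF w wh] a1 by (intro filter_cong) (auto simp: Wl)
  also have "\<dots> = W'"
    using distinct_whites[of u] by (auto simp: Wl intro!: filter_True)
  finally show "whites (u @ [a]) = butlast (whites u)"
    by (subst whites_snoc) (simp add: a1 Wl)
qed

lemma paired_snoc_walk:
  assumes "path.walk 0 (u @ [a])"
  shows "paired (u @ [a]) i j \<longleftrightarrow>
    paired u i j \<or> a = -1 \<and> i = last (whites u) \<and> j = Suc (length u)"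
proof -
  have w: "path.walk 0 u" and a: "a \<in> msteps (path.dest 0 u)"
    using assms by (auto simp: path.walk_append)
  consider "j \<le> length u" | "j = Suc (length u)" | "j > Suc (length u)" by linarith
  then show ?thesis
  proof cases
    case 1
    then show ?thesis by (simp add: paired_snoc_old)
  next
    case 2
    have "last (whites u) \<in> set (whites u)" if "a = -1"
      using whites_snoc_walk(3)[OF assms that] by simp
    then have wl: "white u (last (whites u))" if "a = -1"
      using that by (simp add: set_whites)
    have "\<not> paired u i j" using 2 paired_bound[of u i j] by auto
    moreover have "white u i \<and> segsum u i (length u) + a = 0 \<longleftrightarrow> a = -1 \<and> i = last (whites u)"
      using a
    proof (cases rule: msteps_cases)
      case 3
      then show ?thesis using segsum_white(2)[OF w, of i] wl by auto
    qed (use segsum_white(1)[OF w, of i] in auto)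
    ultimately show ?thesis using paired_snoc_new[of u a i] 2 by blast
  next
    case 3
    then show ?thesis using paired_bound[of u i j] paired_bound[of "u @ [a]" i j] by auto
  qed
qed

text \<open>In a Motzkin path these are the flat steps, as \<open>isolated_snoc\<close> shows one
  step at a time.\<close>

definition isolated :: "int list \<Rightarrow> nat \<Rightarrow> bool" where
  "isolated p i \<longleftrightarrow> 1 \<le> i \<and> i \<le> length p \<and> \<not> white p i \<and> \<not> (\<exists>j. paired p i j \<or> paired p j i)"

lemma isolated_snoc:
  assumes "path.walk 0 (u @ [a])"
  shows "isolated (u @ [a]) i \<longleftrightarrow> isolated u i \<or> a = 0 \<and> i = Suc (length u)"
proof -
  have a: "a \<in> msteps (path.dest 0 u)" using assms by (auto simp: path.walk_append)
  note P = paired_snoc_walk[OF assms]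
  note W = whites_snoc_walk[OF assms]
  have wh: "white p i \<longleftrightarrow> i \<in> set (whites p)" for p i by (simp add: set_whites)
  have bw: "1 \<le> i \<and> i \<le> length u" if "i \<in> set (whites u)" for i
    using that by (simp add: set_whites white_def)
  from a show ?thesis
  proof (cases rule: msteps_cases)
    case 1
    show ?thesis using bw[of i]
      unfolding isolated_def P wh W(1)[OF 1] by (auto simp: 1 dest: paired_bound)
  next
    case 2
    show ?thesis using bw[of i]
      unfolding isolated_def P wh W(2)[OF 2] by (auto simp: 2 dest: paired_bound)
  next
    case 3
    obtain W' l where Wl: "whites u = W' @ [l]" using W(3)[OF 3(1)] by (metis rev_exhaust)
    have "(\<exists>j. paired (u @ [a]) i j \<or> paired (u @ [a]) j i) \<longleftrightarrow>
        (\<exists>j. paired u i j \<or> paired u j i) \<or> i = l \<or> i = Suc (length u)"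
      unfolding P using 3 Wl by auto
    moreover have "white u i \<longleftrightarrow> white (u @ [a]) i \<or> i = l"
      unfolding wh W(4)[OF 3(1)] Wl by auto
    moreover have "i = l \<Longrightarrow> 1 \<le> i \<and> i \<le> length u" using bw[of i] Wl by auto
    ultimately show ?thesis using 3 unfolding isolated_def by auto
  qed
qed

section \<open>The colour model\<close>

text \<open>A pushdown check of a colouring: the stack holds the colours of the pending up-steps,
  latest first, and the final stack must spell \<open>b\<close> from the bottom. The recursion is
  that of \<open>word\<close>, which allows a comparison with the vector of a path.\<close>

fun accepts :: "nat list \<Rightarrow> nat list \<Rightarrow> int list \<Rightarrow> nat list \<Rightarrow> bool" where
  "accepts b st [] \<tau> = (\<tau> = [] \<and> rev st = b)"
| "accepts b st (a # p) [] = False"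
| "accepts b st (a # p) (c # \<tau>) =
     (if a = 1 then accepts b (c # st) p \<tau>
      else if a = 0 then c = 0 \<and> accepts b st p \<tau>
      else st \<noteq> [] \<and> hd st = c \<and> accepts b (tl st) p \<tau>)"

definition consistent :: "int list \<Rightarrow> nat list \<Rightarrow> bool" where
  "consistent p \<sigma> \<longleftrightarrow> (\<forall>i j. paired p i j \<longrightarrow> \<sigma> ! (i - 1) = \<sigma> ! (j - 1)) \<and>
     (\<forall>i. isolated p i \<longrightarrow> \<sigma> ! (i - 1) = 0)"

definition compatible :: "int list \<Rightarrow> nat list \<Rightarrow> nat list \<Rightarrow> bool" where
  "compatible p b \<sigma> \<longleftrightarrow> length \<sigma> = length p \<and> consistent p \<sigma> \<and>
     map (\<lambda>i. \<sigma> ! (i - 1)) (whites p) = b"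

lemma consistent_snoc:
  assumes w: "path.walk 0 (u @ [a])" and len: "length \<rho> = length u"
  shows "consistent (u @ [a]) (\<rho> @ [c]) \<longleftrightarrow> consistent u \<rho> \<and>
    (a = 0 \<longrightarrow> c = 0) \<and> (a = -1 \<longrightarrow> \<rho> ! (last (whites u) - 1) = c)"
proof -
  have old: "(\<rho> @ [c]) ! (i - 1) = \<rho> ! (i - 1)" if "1 \<le> i" "i \<le> length u" for i
    using that len by (cases i) (auto simp: nth_append)
  have new: "(\<rho> @ [c]) ! (Suc (length u) - 1) = c" using len by (simp add: nth_append)
  have lw: "1 \<le> last (whites u) \<and> last (whites u) \<le> length u" if "a = -1"
  proof -
    have "last (whites u) \<in> set (whites u)" using whites_snoc_walk(3)[OF w that] by simp
    then show ?thesis by (simp add: set_whites white_def)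
  qed
  have iso: "1 \<le> i \<and> i \<le> length u" if "isolated u i" for i using that by (simp add: isolated_def)
  have pr: "1 \<le> i \<and> i \<le> length u \<and> 1 \<le> j \<and> j \<le> length u" if "paired u i j" for i j
    using paired_bound[OF that] by auto
  have pe: "(\<rho> @ [c]) ! (i - 1) = (\<rho> @ [c]) ! (j - 1) \<longleftrightarrow> \<rho> ! (i - 1) = \<rho> ! (j - 1)"
    if "paired u i j" for i j
    using pr[OF that] old[of i] old[of j] by simp
  have le: "(\<rho> @ [c]) ! (last (whites u) - 1) = (\<rho> @ [c]) ! (Suc (length u) - 1) \<longleftrightarrow>
      \<rho> ! (last (whites u) - 1) = c" if "a = -1"
    using lw[OF that] old[of "last (whites u)"] new by simp
  have ie: "(\<rho> @ [c]) ! (i - 1) = \<rho> ! (i - 1)" if "isolated u i" for i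
    using iso[OF that] old[of i] by simp
  have pairs: "(\<forall>i j. paired (u @ [a]) i j \<longrightarrow> (\<rho> @ [c]) ! (i - 1) = (\<rho> @ [c]) ! (j - 1)) \<longleftrightarrow>
      (\<forall>i j. paired u i j \<longrightarrow> \<rho> ! (i - 1) = \<rho> ! (j - 1)) \<and>
      (a = -1 \<longrightarrow> \<rho> ! (last (whites u) - 1) = c)"
    unfolding paired_snoc_walk[OF w] using pe le by blast
  have isos: "(\<forall>i. isolated (u @ [a]) i \<longrightarrow> (\<rho> @ [c]) ! (i - 1) = 0) \<longleftrightarrow>
      (\<forall>i. isolated u i \<longrightarrow> \<rho> ! (i - 1) = 0) \<and> (a = 0 \<longrightarrow> c = 0)"
    unfolding isolated_snoc[OF w] using ie new by auto
  show ?thesis unfolding consistent_def pairs isos by (simp only: conj_ac)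
qed

text \<open>The part \<open>u\<close> has already been read, and the stack consists of the colours
  of its white vertices; the induction moves one step from \<open>v\<close> to
  \<open>u\<close>.\<close>

lemma accepts_iff:
  assumes "path.walk 0 (u @ v)" "length \<rho> = length u" "length \<tau> = length v"
  shows "accepts b (rev (map (\<lambda>i. \<rho> ! (i - 1)) (whites u))) v \<tau> \<and> consistent u \<rho> \<longleftrightarrow>
    consistent (u @ v) (\<rho> @ \<tau>) \<and> map (\<lambda>i. (\<rho> @ \<tau>) ! (i - 1)) (whites (u @ v)) = b"
  using assms
proof (induction v arbitrary: u \<rho> \<tau>)
  case Nil
  then show ?case by auto
next
  case (Cons a v)
  then obtain c \<tau>' where \<tau>: "\<tau> = c # \<tau>'" by (cases \<tau>) auto
  have w: "path.walk 0 (u @ [a])"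
    using Cons.prems(1) by (simp add: path.walk_append)
  have a: "a \<in> msteps (path.dest 0 u)" using w by (simp add: path.walk_append)
  let ?m = "\<lambda>\<rho> u. map (\<lambda>i. \<rho> ! (i - 1)) (whites u)"
  have old: "?m (\<rho> @ [c]) u = ?m \<rho> u"
  proof (rule map_cong[OF refl])
    fix i assume "i \<in> set (whites u)"
    then have "1 \<le> i" "i \<le> length u" by (auto simp: set_whites white_def)
    then show "(\<rho> @ [c]) ! (i - 1) = \<rho> ! (i - 1)"
      using Cons.prems(2) by (cases i) (auto simp: nth_append)
  qed
  have "accepts b (rev (?m \<rho> u)) (a # v) (c # \<tau>') \<and> consistent u \<rho> \<longleftrightarrow>
      accepts b (rev (?m (\<rho> @ [c]) (u @ [a]))) v \<tau>' \<and> consistent (u @ [a]) (\<rho> @ [c])"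
    using a
  proof (cases rule: msteps_cases)
    case 1
    have "?m (\<rho> @ [c]) (u @ [a]) = ?m \<rho> u @ [c]"
      using old Cons.prems(2) by (simp add: whites_snoc_walk(1)[OF w 1] nth_append)
    then show ?thesis
      using Cons.prems(2) by (simp only: consistent_snoc[OF w]) (auto simp: 1)
  next
    case 2
    have "?m (\<rho> @ [c]) (u @ [a]) = ?m \<rho> u"
      using old by (simp add: whites_snoc_walk(2)[OF w 2])
    then show ?thesis
      using Cons.prems(2) by (simp only: consistent_snoc[OF w]) (auto simp: 2)
  next
    case 3
    note ne = whites_snoc_walk(3)[OF w 3(1)]
    have "?m (\<rho> @ [c]) (u @ [a]) = butlast (?m \<rho> u)"
      using old by (auto simp: whites_snoc_walk(4)[OF w 3(1)] map_butlast[symmetric]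
          dest: in_set_butlastD)
    moreover have "hd (rev (?m \<rho> u)) = \<rho> ! (last (whites u) - 1)"
      using ne by (simp add: hd_rev last_map)
    moreover have "rev (butlast xs) = tl (rev xs)" for xs :: "nat list"
      using butlast_rev[of "rev xs"] by simp
    ultimately show ?thesis
      using Cons.prems(2) ne
      by (simp only: consistent_snoc[OF w]) (auto simp: 3)
  qed
  also have "\<dots> \<longleftrightarrow> consistent (u @ a # v) (\<rho> @ \<tau>) \<and> ?m (\<rho> @ \<tau>) (u @ a # v) = b"
    using Cons.IH[of "u @ [a]" "\<rho> @ [c]" \<tau>'] Cons.prems \<tau> by simp
  finally show ?case by (simp add: \<tau>)
qed

corollary accepts_iff_compatible:
  assumes "path.walk 0 p" "length \<sigma> = length p"
  shows "accepts b [] p \<sigma> \<longleftrightarrow> compatible p b \<sigma>"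
  using accepts_iff[of "[]" p "[]" \<sigma> b] assms paired_bound[of "[]"]
  by (auto simp: compatible_def consistent_def whites_def isolated_def)

text \<open>There is a single state and \<open>N + 1\<close> colours; a cup forces equal colours on
  its ends and a dot forces colour 0. Vectors of paths are indicators of admissible colourings, so
  pairing two of them counts common colourings.\<close>

locale colour_model =
  fixes N :: nat
begin

sublocale cup_model "\<lambda>_::unit. {0..N}" "\<lambda>_ _. ()" 0 "\<lambda>_ a b. if a = b then 1 else 0" "\<lambda>_ _. 1"
    "\<lambda>_ a b. if a = b then 1 else 0" "rat_of_nat (Suc N)"
  by unfold_locales (auto simp: if_distrib[of "\<lambda>t. t * _"] if_distrib[of "\<lambda>t. _ * t"] cong: if_cong)

definition base :: "nat list \<Rightarrow> nat list \<Rightarrow> rat" where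
  "base b = (\<lambda>\<sigma>. if \<sigma> = b then 1 else 0)"

lemma vec_word:
  "path.walk (length cs) p \<Longrightarrow> length \<tau> = length p \<Longrightarrow>
    vec () (base b) (word (length cs) p) (cs @ \<tau>) = (if accepts b (rev cs) p \<tau> then 1 else 0)"
proof (induction p arbitrary: cs \<tau>)
  case Nil
  then show ?case by (simp add: base_def)
next
  case (Cons a p)
  then obtain c \<tau>' where \<tau>: "\<tau> = c # \<tau>'" by (cases \<tau>) auto
  have "a \<in> msteps (length cs)" using Cons.prems by simp
  then show ?case
  proof (cases rule: msteps_cases)
    case 1
    then show ?thesis using Cons.IH[of "cs @ [c]" \<tau>'] Cons.prems \<tau> by simp
  next
    case 2
    then show ?thesis using Cons.IH[of cs \<tau>'] Cons.prems \<tau> dot_append[of cs _ c \<tau>'] by simp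
  next
    case 3
    then obtain cs' e where cs: "cs = cs' @ [e]" by (metis length_0_conv rev_exhaust)
    show ?thesis using Cons.IH[of cs' \<tau>'] Cons.prems \<tau> 3 cup_append[of "()" cs' _ e c \<tau>']
      by (auto simp: cs)
  qed
qed

lemma walk_iff: "walk s \<sigma> \<longleftrightarrow> set \<sigma> \<subseteq> {0..N}"
  by (induction \<sigma> arbitrary: s) auto

lemma wt_eq: "wt s \<sigma> = 1"
  by (induction \<sigma> arbitrary: s) auto

text \<open>One pairing is computed twice, by counting and by \<open>bil_vec\<close>. Distinct
  nonzero boundary colours make the bottom vectors vanish under caps and cuts.\<close>

theorem card_compatible:
  assumes p: "p \<in> motzkin_paths k r" and q: "q \<in> motzkin_paths k r"
    and b: "distinct b" "length b = r" "set b \<subseteq> {1..N}"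
    and b': "distinct b'" "length b' = r" "set b' \<subseteq> {1..N}"
  shows "rat_of_nat (card {\<sigma>. set \<sigma> \<subseteq> {0..N} \<and> compatible p b \<sigma> \<and> compatible q b' \<sigma>}) =
    (case ev (word 0 p) (word 0 q) of None \<Rightarrow> 0
     | Some n \<Rightarrow> if b = b' then rat_of_nat (Suc N) ^ n else 0)"
proof -
  have wp: "path.walk 0 p" "length p = k" "sum_list p = int r"
    and wq: "path.walk 0 q" "length q = k" "sum_list q = int r"
    using p q by (auto simp: path.motzkin_paths_eq)
  have vec: "vec () (base c) (word 0 s) \<sigma> = (if compatible s c \<sigma> then 1 else 0)"
    if "path.walk 0 s" "length \<sigma> = length s" for c s \<sigma>
    using vec_word[of "[]" s \<sigma> c] accepts_iff_compatible[of s \<sigma> c] that by simp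
  have "bil () k (vec () (base b) (word 0 p)) (vec () (base b') (word 0 q)) =
      (\<Sum>\<sigma> | walk () \<sigma> \<and> length \<sigma> = k. if compatible p b \<sigma> \<and> compatible q b' \<sigma> then 1 else 0)"
    unfolding bil_eq_sum by (intro sum.cong) (auto simp: vec wp wq wt_eq)
  also have "\<dots> = rat_of_nat (card ({\<sigma>. walk () \<sigma> \<and> length \<sigma> = k} \<inter>
      {\<sigma>. compatible p b \<sigma> \<and> compatible q b' \<sigma>}))"
    by (simp add: sum.If_cases[OF finite_walks])
  also have "{\<sigma>. walk () \<sigma> \<and> length \<sigma> = k} \<inter> {\<sigma>. compatible p b \<sigma> \<and> compatible q b' \<sigma>} =
      {\<sigma>. set \<sigma> \<subseteq> {0..N} \<and> compatible p b \<sigma> \<and> compatible q b' \<sigma>}"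
    using wp by (auto simp: walk_iff compatible_def)
  finally have count: "bil () k (vec () (base b) (word 0 p)) (vec () (base b') (word 0 q)) =
      rat_of_nat (card {\<sigma>. set \<sigma> \<subseteq> {0..N} \<and> compatible p b \<sigma> \<and> compatible q b' \<sigma>})" .
  have "bil () r (base b) (base b') =
      (\<Sum>\<sigma> | walk () \<sigma> \<and> length \<sigma> = r. if \<sigma> = b then (if b = b' then 1 else 0) else 0)"
    unfolding bil_eq_sum base_def by (intro sum.cong) (auto simp: wt_eq)
  also have "\<dots> = (if b = b' then 1 else 0)"
    using b by (subst sum.delta[OF finite_walks]) (auto simp: walk_iff)
  finally have bb: "bil () r (base b) (base b') = (if b = b' then 1 else 0)" .
  have cut: "cut i (base b') \<sigma> = 0" for i \<sigma>
    unfolding base_def using b' by (intro cut_indicator) auto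
  have cap: "cap () i (base b') \<sigma> = 0" for i \<sigma>
    unfolding base_def using b' by (intro cap_indicator) (auto simp: nth_eq_iff_index_eq)
  have "bil () (wsize r (word 0 p)) (vec () (base b) (word 0 p)) (vec () (base b') (word 0 q)) =
    (case ev (word 0 p) (word 0 q) of None \<Rightarrow> 0
     | Some n \<Rightarrow> rat_of_nat (Suc N) ^ n * bil () r (base b) (base b'))"
    using path.word_wword[of 0 p r] path.word_wword[of 0 q r] wp wq cut cap
    by (intro bil_vec) auto
  then show ?thesis
    using path.word_wword[of 0 p r] wp unfolding count[symmetric] bb
    by (auto split: option.splits)
qed

end

section \<open>Matchings and orbits of two involutions\<close>

text \<open>The alternating orbit begins with \<open>g\<close> because its start will be a fixed
  point of \<open>f\<close>.\<close>

primrec zigzag :: "('a \<Rightarrow> 'a) \<Rightarrow> ('a \<Rightarrow> 'a) \<Rightarrow> 'a \<Rightarrow> nat \<Rightarrow> 'a" where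
  "zigzag f g x 0 = x"
| "zigzag f g x (Suc m) = (if even m then g else f) (zigzag f g x m)"

text \<open>A component under two involutions is a path or a cycle. Starting from an end it is a
  path, with at most one further end \<open>e\<close>; the flag \<open>b\<close> tells whether
  \<open>f\<close> or \<open>g\<close> fixes it. If the path is infinite, no further fixed incidence
  occurs and \<open>e\<close> is arbitrary.\<close>

lemma involutions_fixed_incidences:
  fixes f g :: "'a \<Rightarrow> 'a"
  assumes f: "\<And>v. f (f v) = v" and g: "\<And>v. g (g v) = v" and x: "f x = x"
    and E: "E \<subseteq> {(v, f v) | v. True} \<union> {(v, g v) | v. True}"
  obtains e :: 'a and b :: bool where
    "\<And>v. (x, v) \<in> E\<^sup>* \<Longrightarrow> f v = v \<Longrightarrow> v = x \<or> v = e \<and> b"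
    "\<And>v. (x, v) \<in> E\<^sup>* \<Longrightarrow> g v = v \<Longrightarrow> v = e \<and> \<not> b"
proof -
  define s where "s = zigzag f g x"
  define M where "M = (LEAST m. s (Suc m) = s m)"
  have s_0: "s 0 = x" and s_Suc: "s (Suc m) = (if even m then g else f) (s m)" for m
    by (simp_all add: s_def)
  have undo: "(if even m then g else f) (s (Suc m)) = s m" for m
    by (auto simp: s_Suc f g)
  have closed_f: "f (s m) \<in> s ` {..Suc m}" for m
  proof (cases "even m")
    case True
    show ?thesis
    proof (cases m)
      case 0
      then have "f (s m) = s 0" using x by (simp add: s_0)
      then show ?thesis by blast
    next
      case (Suc l)
      then have "f (s m) = s l" using True undo[of l] by simp
      then show ?thesis using Suc by auto
    qed
  next
    case False
    then have "f (s m) = s (Suc m)" by (simp add: s_Suc)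
    then show ?thesis by blast
  qed
  have closed_g: "g (s m) \<in> s ` {..Suc m}" for m
  proof (cases "even m")
    case False
    then obtain l where l: "m = Suc l" by (cases m) auto
    then have "g (s m) = s l" using False undo[of l] by simp
    then show ?thesis using l by auto
  next
    case True
    then have "g (s m) = s (Suc m)" by (simp add: s_Suc)
    then show ?thesis by blast
  qed
  have orbit: "\<exists>m. v = s m" if "(x, v) \<in> E\<^sup>*" for v
    using that
  proof (induction rule: rtrancl_induct)
    case base
    show ?case using s_0 by metis
  next
    case (step v w)
    then obtain m where "v = s m" by blast
    moreover have "w = f v \<or> w = g v" using step(2) E by auto
    ultimately show ?case using closed_f[of m] closed_g[of m] by auto
  qed
  \<comment> \<open>After a repetition the orbit runs back along itself and produces no new
    values.\<close>
  have bound: "s m \<in> s ` {..l}" if l: "s (Suc l) = s l" for l m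
  proof (induction m)
    case (Suc m)
    then obtain i where i: "i \<le> l" "s m = s i" by auto
    have "s j \<in> s ` {..l}" if "j \<le> Suc i" for j
    proof (cases "j = Suc l")
      case True
      then show ?thesis using l by simp
    next
      case False
      then show ?thesis using that i(1) by simp
    qed
    then have "f (s i) \<in> s ` {..l}" "g (s i) \<in> s ` {..l}"
      using closed_f[of i] closed_g[of i] by auto
    then show ?case by (simp add: s_Suc i(2))
  qed auto
  \<comment> \<open>At the first visit to \<open>v\<close>, the involution used for leaving fixes
    \<open>v\<close> only at the far end, and the one used for arriving fixes it only at the
    start.\<close>
  have incidence: "t \<and> v = x \<or> v = s M \<and> t = odd M"
    if v: "\<exists>m. v = s m" and t: "(if t then f else g) v = v" for v t
  proof -
    define i where "i = (LEAST m. v = s m)"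
    have i: "v = s i" and imin: "\<And>m. v = s m \<Longrightarrow> i \<le> m"
      unfolding i_def using v by (auto intro: LeastI_ex Least_le)
    show ?thesis
    proof (cases "t = odd i")
      case True
      then have si: "s (Suc i) = s i" using t i by (auto simp: s_Suc split: if_splits)
      then have M: "s (Suc M) = s M" "M \<le> i" unfolding M_def by (auto intro: LeastI Least_le)
      then obtain j where "j \<le> M" "s i = s j" using bound[of M i] by auto
      then have "i = M" using imin[of j] i M by simp
      then show ?thesis using i True by auto
    next
      case False
      show ?thesis
      proof (cases i)
        case 0
        then show ?thesis using False i by (simp add: s_0)
      next
        case (Suc l)
        then have "s l = v" using False t undo[of l] i by (auto split: if_splits)
        then have "i \<le> l" using imin[of l] by simp
        then show ?thesis using Suc by simp
      qed
    qed
  qed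
  show thesis
  proof (rule that[of "s M" "odd M"])
    fix v assume v: "(x, v) \<in> E\<^sup>*"
    show "f v = v \<Longrightarrow> v = x \<or> v = s M \<and> odd M"
      using incidence[OF orbit[OF v], of True] by auto
    show "g v = v \<Longrightarrow> v = s M \<and> \<not> odd M"
      using incidence[OF orbit[OF v], of False] by auto
  qed
qed

definition edges :: "int list \<Rightarrow> (nat \<times> nat) set" where
  "edges p = {(i, j). paired p i j \<or> paired p j i}"

lemma edges_sym: "(i, j) \<in> edges p \<Longrightarrow> (j, i) \<in> edges p"
  by (auto simp: edges_def)

lemma edges_bound: "(i, j) \<in> edges p \<Longrightarrow> i \<in> {1..length p} \<and> j \<in> {1..length p}"
  by (auto simp: edges_def dest: paired_bound)

lemma edges_matching:
  "path.walk 0 p \<Longrightarrow> (\<forall>i j j'. (i, j) \<in> edges p \<longrightarrow> (i, j') \<in> edges p \<longrightarrow> j = j') \<and>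
    (\<forall>i j. (i, j) \<in> edges p \<longrightarrow> \<not> white p i)"
proof (induction p rule: rev_induct)
  case Nil
  then show ?case by (auto simp: edges_def dest: paired_bound)
next
  case (snoc a u)
  then have w: "path.walk 0 u" and a: "a \<in> msteps (path.dest 0 u)" by (auto simp: path.walk_append)
  note P = paired_snoc_walk[OF snoc.prems] and W = whites_snoc_walk[OF snoc.prems]
  let ?n = "Suc (length u)"
  have uniq: "\<And>i j j'. (i, j) \<in> edges u \<Longrightarrow> (i, j') \<in> edges u \<Longrightarrow> j = j'"
    and nw: "\<And>i j. (i, j) \<in> edges u \<Longrightarrow> i \<notin> set (whites u)"
    using snoc.IH w by (auto simp: set_whites)
  have n: "i \<noteq> ?n \<and> j \<noteq> ?n" if "(i, j) \<in> edges u" for i j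
    using edges_bound[OF that] by auto
  have wn: "?n \<notin> set (whites u)" by (auto simp: set_whites white_def)
  have wh: "white s i \<longleftrightarrow> i \<in> set (whites s)" for s i by (simp add: set_whites)
  show ?case
  proof (cases "a = -1")
    case True
    obtain W' l where Wl: "whites u = W' @ [l]" using W(3)[OF True] by (metis rev_exhaust)
    have E: "edges (u @ [a]) = edges u \<union> {(l, ?n), (?n, l)}"
      unfolding edges_def P by (auto simp: True Wl)
    have l: "(l, j) \<notin> edges u" for j using nw[of l j] Wl by auto
    have ln: "l \<noteq> ?n" using wn Wl by auto
    have "l \<notin> set W'" using distinct_whites[of u] Wl by auto
    then show ?thesis
      unfolding E wh W(4)[OF True] Wl using uniq nw n l ln wn Wl
      by (auto dest: n)
  next
    case False
    then have E: "edges (u @ [a]) = edges u" unfolding edges_def P by auto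
    have "set (whites (u @ [a])) \<subseteq> set (whites u) \<union> {?n}"
      using a False W(1,2) by (cases rule: msteps_cases) auto
    then show ?thesis unfolding E wh using uniq nw n by blast
  qed
qed

section \<open>Colourings of two superposed one-factors\<close>

text \<open>Uncovered vertices are made fixed points, so that a matching becomes an involution and
  the ends of components become its fixed points.\<close>

definition mate :: "int list \<Rightarrow> nat \<Rightarrow> nat" where
  "mate p i = (if \<exists>j. (i, j) \<in> edges p then THE j. (i, j) \<in> edges p else i)"

lemma mate_edge:
  assumes "path.walk 0 p" "(i, j) \<in> edges p"
  shows "mate p i = j"
proof -
  have "(THE j. (i, j) \<in> edges p) = j"
    using edges_matching[OF assms(1)] assms(2) by blast
  then show ?thesis using assms(2) by (auto simp: mate_def)
qed

lemma mate_mate: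
  assumes "path.walk 0 p"
  shows "mate p (mate p i) = i"
proof (cases "\<exists>j. (i, j) \<in> edges p")
  case True
  then obtain j where j: "(i, j) \<in> edges p" by blast
  then show ?thesis using mate_edge[OF assms j] mate_edge[OF assms edges_sym[OF j]] by simp
qed (simp add: mate_def)

lemma mate_white: "path.walk 0 p \<Longrightarrow> white p i \<Longrightarrow> mate p i = i"
  using edges_matching[of p] by (auto simp: mate_def)

lemma mate_isolated: "isolated p i \<Longrightarrow> mate p i = i"
  by (auto simp: mate_def isolated_def edges_def)

locale two_paths =
  fixes p q :: "int list" and k r :: nat
  assumes p_path: "p \<in> motzkin_paths k r" and q_path: "q \<in> motzkin_paths k r"
begin

lemma walk_p: "path.walk 0 p" and walk_q: "path.walk 0 q"
  and length_p: "length p = k" and length_q: "length q = k"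
  using p_path q_path by (auto simp: path.motzkin_paths_eq)

lemma whites_p_length: "length (whites p) = r" and whites_q_length: "length (whites q) = r"
  using length_whites p_path q_path by auto

text \<open>Both one-factors are superposed on one row, which is the middle row of the stacked
  picture.\<close>

definition E :: "(nat \<times> nat) set" where "E = edges p \<union> edges q"

definition through :: "(nat \<times> nat) set" where
  "through = {(a, b). white p a \<and> white q b \<and> (a, b) \<in> E\<^sup>*}"

definition loops :: "nat set set" where
  "loops = {C. \<exists>v. C = E\<^sup>* `` {v} \<and>
     (\<forall>w\<in>C. (\<exists>j. (w, j) \<in> edges p) \<and> (\<exists>j. (w, j) \<in> edges q))}"

lemma sym_E: "sym E"
  by (auto simp: sym_def E_def dest: edges_sym)

lemma conn_sym: "(a, b) \<in> E\<^sup>* \<Longrightarrow> (b, a) \<in> E\<^sup>*"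
  using sym_rtrancl[OF sym_E] by (auto dest: symD)

lemma conn_class: "(a, b) \<in> E\<^sup>* \<Longrightarrow> E\<^sup>* `` {a} = E\<^sup>* `` {b}"
  by (auto intro: rtrancl_trans conn_sym)

lemma E_vertex: "(a, b) \<in> E \<Longrightarrow> a \<in> {1..k} \<and> b \<in> {1..k}"
  using edges_bound[of a b p] edges_bound[of a b q] length_p length_q by (auto simp: E_def)

lemma conn_vertex: "(a, b) \<in> E\<^sup>* \<Longrightarrow> a \<in> {1..k} \<Longrightarrow> b \<in> {1..k}"
  by (induction rule: rtrancl_induct) (auto dest: E_vertex)

lemma isolated_vertex: "isolated p a \<Longrightarrow> a \<in> {1..k}" "isolated q a \<Longrightarrow> a \<in> {1..k}"
  using length_p length_q by (auto simp: isolated_def)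

lemma vertex_cases_p: "i \<in> {1..k} \<Longrightarrow> (\<exists>j. (i, j) \<in> edges p) \<or> white p i \<or> isolated p i"
  using length_p by (auto simp: isolated_def edges_def)

lemma vertex_cases_q: "i \<in> {1..k} \<Longrightarrow> (\<exists>j. (i, j) \<in> edges q) \<or> white q i \<or> isolated q i"
  using length_q by (auto simp: isolated_def edges_def)

lemma not_covered:
  "white p i \<or> isolated p i \<Longrightarrow> (i, j) \<notin> edges p"
  "white q i \<or> isolated q i \<Longrightarrow> (i, j) \<notin> edges q"
  using edges_matching[OF walk_p] edges_matching[OF walk_q]
  by (auto simp: isolated_def edges_def)

lemma loops_class_iff:
  "E\<^sup>* `` {v} \<in> loops \<longleftrightarrow>
    (\<forall>w. (v, w) \<in> E\<^sup>* \<longrightarrow> (\<exists>j. (w, j) \<in> edges p) \<and> (\<exists>j. (w, j) \<in> edges q))"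
proof
  assume "E\<^sup>* `` {v} \<in> loops"
  then show "\<forall>w. (v, w) \<in> E\<^sup>* \<longrightarrow> (\<exists>j. (w, j) \<in> edges p) \<and> (\<exists>j. (w, j) \<in> edges q)"
    unfolding loops_def by auto
qed (auto simp: loops_def)

lemma loopsE:
  assumes "C \<in> loops"
  obtains v where "C = E\<^sup>* `` {v}" "v \<in> {1..k}"
proof -
  from assms obtain v where v: "C = E\<^sup>* `` {v}"
    "\<forall>w\<in>C. (\<exists>j. (w, j) \<in> edges p) \<and> (\<exists>j. (w, j) \<in> edges q)" by (auto simp: loops_def)
  then have "v \<in> {1..k}" using edges_bound[of v _ p] length_p by auto
  then show thesis using that v by blast
qed

lemma finite_loops: "finite loops"
proof (rule finite_subset)
  show "loops \<subseteq> (\<lambda>v. E\<^sup>* `` {v}) ` {1..k}" by (auto elim: loopsE)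
qed simp

lemma compatible_iff:
  assumes "length \<sigma> = k"
  shows "compatible p b \<sigma> \<longleftrightarrow> (\<forall>i j. (i, j) \<in> edges p \<longrightarrow> \<sigma> ! (i - 1) = \<sigma> ! (j - 1)) \<and>
      (\<forall>i. isolated p i \<longrightarrow> \<sigma> ! (i - 1) = 0) \<and> map (\<lambda>i. \<sigma> ! (i - 1)) (whites p) = b"
    and "compatible q b \<sigma> \<longleftrightarrow> (\<forall>i j. (i, j) \<in> edges q \<longrightarrow> \<sigma> ! (i - 1) = \<sigma> ! (j - 1)) \<and>
      (\<forall>i. isolated q i \<longrightarrow> \<sigma> ! (i - 1) = 0) \<and> map (\<lambda>i. \<sigma> ! (i - 1)) (whites q) = b"
  using assms length_p length_q by (auto simp: compatible_def consistent_def edges_def)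

text \<open>The colour \<open>N\<close> is kept in reserve: no white vertex receives it.\<close>

definition N :: nat where "N = Suc r"

definition colours :: "nat list" where "colours = [1..<Suc r]"

definition colourings :: "nat list \<Rightarrow> nat list \<Rightarrow> nat list set" where
  "colourings b b' = {\<sigma>. set \<sigma> \<subseteq> {0..N} \<and> compatible p b \<sigma> \<and> compatible q b' \<sigma>}"

lemma finite_colourings: "finite (colourings b b')"
  by (rule finite_subset[OF _ finite_lists_length_eq[of "{0..N}" k]])
    (auto simp: colourings_def compatible_def length_p)

lemma colourings_conn:
  assumes "\<sigma> \<in> colourings b b'" "(v, w) \<in> E\<^sup>*"
  shows "\<sigma> ! (v - 1) = \<sigma> ! (w - 1)"
  using assms(2)
proof (induction rule: rtrancl_induct)
  case (step v w)
  have "length \<sigma> = k" using assms(1) length_p by (simp add: colourings_def compatible_def)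
  then have "\<sigma> ! (v - 1) = \<sigma> ! (w - 1)"
    using step(2) assms(1) compatible_iff[of \<sigma>] by (auto simp: E_def colourings_def)
  then show ?case using step.IH by simp
qed simp

definition paint :: "(nat \<Rightarrow> nat) \<Rightarrow> nat list" where
  "paint c = map c [1..<Suc k]"

lemma paint_nth: "v \<in> {1..k} \<Longrightarrow> paint c ! (v - 1) = c v"
  by (auto simp: paint_def nth_append nth_map_upt simp del: upt_Suc)

lemma paint_in_colourings:
  assumes bound: "\<And>v. v \<in> {1..k} \<Longrightarrow> c v \<le> N"
    and edge: "\<And>v w. (v, w) \<in> E \<Longrightarrow> c v = c w"
    and iso: "\<And>v. isolated p v \<or> isolated q v \<Longrightarrow> c v = 0"
  shows "paint c \<in> colourings (map c (whites p)) (map c (whites q))"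
proof -
  have len: "length (paint c) = k" by (simp add: paint_def)
  have "map (\<lambda>i. paint c ! (i - 1)) (whites s) = map c (whites s)" if "length s = k" for s
    using that by (intro map_cong refl paint_nth) (auto simp: set_whites white_def)
  moreover have "set (paint c) \<subseteq> {0..N}" using bound by (auto simp: paint_def)
  moreover have "paint c ! (v - 1) = paint c ! (w - 1)" if "(v, w) \<in> E" for v w
    using E_vertex[OF that] edge[OF that] paint_nth[of v c] paint_nth[of w c] by simp
  moreover have "paint c ! (v - 1) = 0" if "isolated p v \<or> isolated q v" for v
    using that iso[OF that] isolated_vertex paint_nth[of v c] by auto
  ultimately show ?thesis
    using length_p length_q by (auto simp: colourings_def compatible_iff[OF len] E_def)
qed

text \<open>All information about \<open>ev\<close> used below is read off from these
  cardinalities.\<close>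

lemma card_colourings:
  assumes "distinct b" "length b = r" "set b \<subseteq> {1..N}"
    and "distinct b'" "length b' = r" "set b' \<subseteq> {1..N}"
  shows "card (colourings b b') = (case ev (word 0 p) (word 0 q) of None \<Rightarrow> 0
     | Some n \<Rightarrow> if b = b' then Suc N ^ n else 0)"
proof -
  interpret colour_model N .
  have "rat_of_nat (card (colourings b b')) = rat_of_nat (case ev (word 0 p) (word 0 q) of None \<Rightarrow> 0
     | Some n \<Rightarrow> if b = b' then Suc N ^ n else 0)"
    unfolding colourings_def using card_compatible[OF p_path q_path assms]
    by (auto split: option.splits simp del: of_nat_Suc)
  then show ?thesis using of_nat_eq_iff by blast
qed

lemma colours: "distinct colours" "length colours = r" "set colours \<subseteq> {1..N}"
  by (auto simp: colours_def N_def)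

lemma colours_nth: "s < r \<Longrightarrow> colours ! s = Suc s"
  by (simp add: colours_def nth_append del: upt_Suc)

lemma whites_nth_colour:
  assumes "\<sigma> \<in> colourings b b'" "s < r"
  shows "\<sigma> ! (whites p ! s - 1) = b ! s" "\<sigma> ! (whites q ! s - 1) = b' ! s"
  using assms whites_p_length whites_q_length
  by (auto simp: colourings_def compatible_def)


section \<open>From numbers of colourings to components\<close>

lemma white_nth:
  "white p a \<Longrightarrow> \<exists>s<r. a = whites p ! s" "white q a \<Longrightarrow> \<exists>s<r. a = whites q ! s"
  "s < r \<Longrightarrow> white p (whites p ! s)" "s < r \<Longrightarrow> white q (whites q ! s)"
  using whites_p_length whites_q_length set_whites[of p] set_whites[of q]
  by (metis in_set_conv_nth mem_Collect_eq nth_mem)+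

lemma white_reaches_white:
  assumes ev: "ev (word 0 p) (word 0 q) = Some n" and s: "s < r"
  shows "(whites p ! s, whites q ! s) \<in> E\<^sup>*"
proof -
  have "colourings colours colours \<noteq> {}"
    using card_colourings[OF colours colours] ev by (auto simp: finite_colourings card_gt_0_iff)
  then obtain \<sigma> where \<sigma>: "\<sigma> \<in> colourings colours colours" by blast
  let ?a = "whites p ! s"
  define c where "c v = \<sigma> ! (v - 1)" for v
  have conn: "c v = c w" if "(v, w) \<in> E\<^sup>*" for v w
    using colourings_conn[OF \<sigma> that] by (simp add: c_def)
  have cp: "c (whites p ! t) = Suc t" and cq: "c (whites q ! t) = Suc t" if "t < r" for t
    using whites_nth_colour[OF \<sigma> that] that by (simp_all add: c_def colours_nth)
  have len: "length \<sigma> = k" using \<sigma> length_p by (simp add: colourings_def compatible_def)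
  have iso: "c v = 0" if "isolated p v \<or> isolated q v" for v
    using \<sigma> that by (auto simp: colourings_def compatible_iff[OF len] c_def)
  have "\<exists>b. white q b \<and> (?a, b) \<in> E\<^sup>*"
  proof (rule ccontr)
    assume none: "\<not> ?thesis"
    \<comment> \<open>Recolouring the component of this white vertex with a fresh colour changes only one
      boundary value, which the product formula forbids.\<close>
    define c' where "c' v = (if (?a, v) \<in> E\<^sup>* then N else c v)" for v
    have "paint c' \<in> colourings (map c' (whites p)) (map c' (whites q))"
    proof (rule paint_in_colourings)
      fix v assume v: "v \<in> {1..k}"
      have "\<sigma> ! (v - 1) \<in> set \<sigma>" using v len by (intro nth_mem) auto
      then show "c' v \<le> N" using \<sigma> by (auto simp: c'_def c_def colourings_def)
    next
      fix v w assume vw: "(v, w) \<in> E"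
      then have "(?a, v) \<in> E\<^sup>* \<longleftrightarrow> (?a, w) \<in> E\<^sup>*"
        using sym_E by (meson rtrancl.rtrancl_into_rtrancl symD)
      then show "c' v = c' w" using conn[OF r_into_rtrancl[OF vw]] by (simp add: c'_def)
    next
      fix v assume v: "isolated p v \<or> isolated q v"
      then have "(?a, v) \<notin> E\<^sup>*" using conn[of ?a v] iso[OF v] cp[OF s] by auto
      then show "c' v = 0" using iso[OF v] by (simp add: c'_def)
    qed
    moreover have "map c' (whites q) = colours"
    proof (rule nth_equalityI)
      fix t assume "t < length (map c' (whites q))"
      then have t: "t < r" using whites_q_length by simp
      then show "map c' (whites q) ! t = colours ! t"
        using none white_nth(4)[OF t] cq[OF t] whites_q_length by (auto simp: c'_def colours_nth)
    qed (simp add: colours whites_q_length)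
    moreover have "map c' (whites p) = colours[s := N]"
    proof (rule nth_equalityI)
      fix t assume "t < length (map c' (whites p))"
      then have t: "t < r" using whites_p_length by simp
      have "(?a, whites p ! t) \<in> E\<^sup>* \<longleftrightarrow> t = s"
        using conn[of ?a "whites p ! t"] cp[OF t] cp[OF s] by auto
      then show "map c' (whites p) ! t = colours[s := N] ! t"
        using cp[OF t] t whites_p_length colours(2)
        by (auto simp: c'_def colours_nth nth_list_update)
    qed (simp add: colours whites_p_length)
    ultimately have "colourings (colours[s := N]) colours \<noteq> {}" by auto
    moreover have "N \<notin> set colours" by (auto simp: colours_def N_def)
    moreover from this have "distinct (colours[s := N])"
      using colours(1) by (simp add: distinct_list_update)
    moreover have "set (colours[s := N]) \<subseteq> {1..N}"
      using set_update_subset_insert[of colours s N] colours(3) by (auto simp: N_def)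
    moreover have "colours[s := N] \<noteq> colours"
      using calculation(2) s colours(2) by (metis nth_list_update_eq nth_mem)
    ultimately show False
      using card_colourings[of "colours[s := N]" colours] colours ev finite_colourings
      by simp
  qed
  then obtain b where b: "white q b" "(?a, b) \<in> E\<^sup>*" by blast
  then obtain t where t: "t < r" "b = whites q ! t" using white_nth(2) by blast
  then have "t = s" using conn[OF b(2)] cp[OF s] cq[of t] by simp
  then show ?thesis using b t by simp
qed

lemma card_through:
  assumes ev: "ev (word 0 p) (word 0 q) = Some n"
  shows "card through = r"
proof -
  have "colourings colours colours \<noteq> {}"
    using card_colourings[OF colours colours] ev by (auto simp: finite_colourings card_gt_0_iff)
  then obtain \<sigma> where \<sigma>: "\<sigma> \<in> colourings colours colours" by blast
  have "through = (\<lambda>s. (whites p ! s, whites q ! s)) ` {..<r}"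
  proof (intro equalityI subsetI)
    fix ab assume "ab \<in> through"
    then obtain a b where ab: "ab = (a, b)" "white p a" "white q b" "(a, b) \<in> E\<^sup>*"
      by (auto simp: through_def)
    then obtain s t where st: "s < r" "a = whites p ! s" "t < r" "b = whites q ! t"
      using white_nth(1,2) by blast
    then have "s = t"
      using colourings_conn[OF \<sigma> ab(4)] whites_nth_colour[OF \<sigma>] by (simp add: colours_nth)
    then show "ab \<in> (\<lambda>s. (whites p ! s, whites q ! s)) ` {..<r}" using ab st by auto
  qed (use white_reaches_white[OF ev] white_nth(3,4) in \<open>auto simp: through_def\<close>)
  moreover have "inj_on (\<lambda>s. (whites p ! s, whites q ! s)) {..<r}"
    using distinct_whites[of p] whites_p_length by (auto simp: inj_on_def nth_eq_iff_index_eq)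
  ultimately show ?thesis by (simp add: card_image)
qed

text \<open>A component that is not a loop contains a white or isolated vertex, whose colour is
  prescribed; loops are coloured freely. Comparison with the product formula gives equal powers of
  \<open>N + 1\<close>, which is at least 2.\<close>

lemma card_loops:
  assumes ev: "ev (word 0 p) (word 0 q) = Some n"
  shows "card loops = n"
proof -
  have card: "card (colourings colours colours) = Suc N ^ n"
    using card_colourings[OF colours colours] ev by simp
  then have "colourings colours colours \<noteq> {}"
    by (auto simp: finite_colourings card_gt_0_iff)
  then obtain \<sigma> where \<sigma>: "\<sigma> \<in> colourings colours colours" by blast
  define c where "c v = \<sigma> ! (v - 1)" for v
  have len: "length \<tau> = k" if "\<tau> \<in> colourings colours colours" for \<tau>
    using that length_p by (simp add: colourings_def compatible_def)
  have iso: "\<tau> ! (v - 1) = 0" if "\<tau> \<in> colourings colours colours" "isolated p v \<or> isolated q v" for v \<tau>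
    using that compatible_iff[OF len[OF that(1)]] by (auto simp: colourings_def)
  have wh: "\<tau> ! (v - 1) = c v" if \<tau>: "\<tau> \<in> colourings colours colours" "white p v \<or> white q v" for v \<tau>
    using \<tau>(2) white_nth(1,2)[of v] whites_nth_colour[OF \<tau>(1)] whites_nth_colour[OF \<sigma>]
    by (auto simp: c_def)
  define G where
    "G h = paint (\<lambda>v. if E\<^sup>* `` {v} \<in> loops then h (E\<^sup>* `` {v}) else c v)" for h :: "nat set \<Rightarrow> nat"
  have G_nth: "G h ! (v - 1) = (if E\<^sup>* `` {v} \<in> loops then h (E\<^sup>* `` {v}) else c v)"
    if "v \<in> {1..k}" for h v
    unfolding G_def using that by (rule paint_nth)
  have notloop: "E\<^sup>* `` {v} \<notin> loops" if "white p v \<or> white q v \<or> isolated p v \<or> isolated q v" for v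
    using that not_covered[of v] by (auto simp: loops_class_iff)
  have "bij_betw G (PiE loops (\<lambda>_. {0..N})) (colourings colours colours)"
  proof (rule bij_betw_imageI)
    show "inj_on G (PiE loops (\<lambda>_. {0..N}))"
    proof (rule inj_onI)
      fix h h' assume h: "h \<in> PiE loops (\<lambda>_. {0..N})" "h' \<in> PiE loops (\<lambda>_. {0..N})" "G h = G h'"
      show "h = h'"
      proof (rule PiE_ext[OF h(1,2)])
        fix C assume C: "C \<in> loops"
        then obtain v where "C = E\<^sup>* `` {v}" "v \<in> {1..k}" by (rule loopsE)
        then show "h C = h' C" using G_nth[of v h] G_nth[of v h'] h(3) C by simp
      qed
    qed
    show "G ` PiE loops (\<lambda>_. {0..N}) = colourings colours colours"
    proof (intro equalityI subsetI)
      fix \<tau> assume "\<tau> \<in> G ` PiE loops (\<lambda>_. {0..N})"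
      then obtain h where h: "h \<in> PiE loops (\<lambda>_. {0..N})" "\<tau> = G h" by blast
      let ?c = "\<lambda>v. if E\<^sup>* `` {v} \<in> loops then h (E\<^sup>* `` {v}) else c v"
      have "\<tau> \<in> colourings (map ?c (whites p)) (map ?c (whites q))"
        unfolding h(2) G_def
      proof (rule paint_in_colourings)
        fix v assume v: "v \<in> {1..k}"
        have "\<sigma> ! (v - 1) \<in> set \<sigma>" using v len[OF \<sigma>] by (intro nth_mem) auto
        then show "?c v \<le> N" using h(1) \<sigma> by (auto simp: c_def colourings_def)
      next
        fix v w assume "(v, w) \<in> E"
        then have "(v, w) \<in> E\<^sup>*" by simp
        then show "?c v = ?c w"
          using conn_class[of v w] colourings_conn[OF \<sigma>, of v w] by (simp add: c_def)
      next
        fix v assume "isolated p v \<or> isolated q v"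
        then show "?c v = 0" using notloop[of v] iso[OF \<sigma>, of v] by (auto simp: c_def)
      qed
      moreover have "map ?c (whites s) = map c (whites s)" if "s = p \<or> s = q" for s
        using that notloop by (intro map_cong refl) (auto simp: set_whites)
      moreover have "map c (whites p) = colours" "map c (whites q) = colours"
        using \<sigma> by (auto simp: colourings_def compatible_def c_def[abs_def])
      ultimately show "\<tau> \<in> colourings colours colours" by simp
    next
      fix \<tau> assume \<tau>: "\<tau> \<in> colourings colours colours"
      \<comment> \<open>Colours are constant on components, so any representative of the loop may be
        chosen.\<close>
      define h where "h = restrict (\<lambda>C. \<tau> ! ((SOME v. v \<in> C) - 1)) loops"
      have h: "h (E\<^sup>* `` {v}) = \<tau> ! (v - 1)" if "E\<^sup>* `` {v} \<in> loops" for v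
      proof -
        have "(SOME w. w \<in> E\<^sup>* `` {v}) \<in> E\<^sup>* `` {v}" by (rule someI[of _ v]) simp
        then show ?thesis using colourings_conn[OF \<tau>, of v] that by (simp add: h_def)
      qed
      have "\<tau> = G h"
      proof (rule nth_equalityI)
        show "length \<tau> = length (G h)" using len[OF \<tau>] by (simp add: G_def paint_def)
        fix i assume "i < length \<tau>"
        then have v: "Suc i \<in> {1..k}" using len[OF \<tau>] by simp
        have "\<tau> ! (Suc i - 1) = c (Suc i)" if "E\<^sup>* `` {Suc i} \<notin> loops"
        proof -
          from that obtain w where w: "(Suc i, w) \<in> E\<^sup>*"
            "\<not> ((\<exists>j. (w, j) \<in> edges p) \<and> (\<exists>j. (w, j) \<in> edges q))"
            by (auto simp: loops_class_iff)
          have "\<tau> ! (w - 1) = c w"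
            using vertex_cases_p[OF conn_vertex[OF w(1) v]] vertex_cases_q[OF conn_vertex[OF w(1) v]]
              w(2) wh[OF \<tau>, of w] iso[OF \<tau>, of w] iso[OF \<sigma>, of w] by (auto simp: c_def)
          then show ?thesis
            using colourings_conn[OF \<tau> w(1)] colourings_conn[OF \<sigma> w(1)] by (simp add: c_def)
        qed
        then show "\<tau> ! i = G h ! i" using G_nth[OF v, of h] h[of "Suc i"] by auto
      qed
      moreover have "h \<in> PiE loops (\<lambda>_. {0..N})"
      proof (rule PiE_I)
        fix C assume C: "C \<in> loops"
        then obtain v where v: "C = E\<^sup>* `` {v}" "v \<in> {1..k}" by (rule loopsE)
        then have "h C = \<tau> ! (v - 1)" using h C by simp
        moreover have "\<tau> ! (v - 1) \<in> set \<tau>" using v len[OF \<tau>] by (intro nth_mem) auto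
        ultimately show "h C \<in> {0..N}" using \<tau> by (auto simp: colourings_def)
      qed (simp add: h_def)
      ultimately show "\<tau> \<in> G ` PiE loops (\<lambda>_. {0..N})" by blast
    qed
  qed
  then have "card (colourings colours colours) = Suc N ^ card loops"
    using card_PiE[OF finite_loops, of "\<lambda>_. {0..N}"] by (simp add: bij_betw_same_card[symmetric])
  then show ?thesis using card by (simp add: N_def)
qed


text \<open>The component is a path whose ends are \<open>a\<close>, uncovered by \<open>p\<close>,
  and \<open>b\<close>, uncovered by \<open>q\<close>; a path has no third end.\<close>

lemma through_component:
  assumes "white p a" "white q b" "(a, b) \<in> E\<^sup>*" "(a, v) \<in> E\<^sup>*"
  shows "white p v \<or> isolated p v \<Longrightarrow> v = a" "white q v \<or> isolated q v \<Longrightarrow> v = b"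
proof -
  have E: "E \<subseteq> {(v, mate p v) | v. True} \<union> {(v, mate q v) | v. True}"
    using mate_edge[OF walk_p] mate_edge[OF walk_q] by (auto simp: E_def)
  have fix_p: "mate p v = v" if "white p v \<or> isolated p v" for v
    using that mate_white[OF walk_p] mate_isolated by blast
  have fix_q: "mate q v = v" if "white q v \<or> isolated q v" for v
    using that mate_white[OF walk_q] mate_isolated by blast
  obtain e t where e: "\<And>v. (a, v) \<in> E\<^sup>* \<Longrightarrow> mate p v = v \<Longrightarrow> v = a \<or> v = e \<and> t"
    "\<And>v. (a, v) \<in> E\<^sup>* \<Longrightarrow> mate q v = v \<Longrightarrow> v = e \<and> \<not> t"
    using involutions_fixed_incidences[OF mate_mate[OF walk_p] mate_mate[OF walk_q] _ E]
      fix_p[of a] assms(1) by metis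
  have "b = e \<and> \<not> t" using e(2)[OF assms(3)] fix_q[of b] assms(2) by simp
  then show "white p v \<or> isolated p v \<Longrightarrow> v = a" "white q v \<or> isolated q v \<Longrightarrow> v = b"
    using e[OF assms(4)] fix_p[of v] fix_q[of v] by auto
qed

text \<open>Colouring each through component by the position of its white vertex in
  \<open>p\<close>, and all other vertices by 0, gives an admissible colouring with distinct nonzero
  boundary colours. The count is then positive, which excludes \<open>None\<close>.\<close>

lemma ev_of_through:
  assumes "card through = r"
  shows "ev (word 0 p) (word 0 q) \<noteq> None"
proof -
  have inj_fst: "inj_on fst through" and inj_snd: "inj_on snd through"
    using through_component by (auto simp: inj_on_def through_def) (meson conn_sym rtrancl_trans)
  have card_whites: "card {a. white p a} = r" "card {b. white q b} = r"
    using distinct_card[OF distinct_whites[of p]] distinct_card[OF distinct_whites[of q]]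
    by (simp_all add: set_whites whites_p_length whites_q_length)
  have fin: "finite {a. white p a}" "finite {b. white q b}"
    using set_whites finite_set by metis+
  have fst_through: "fst ` through = {a. white p a}"
    using card_image[OF inj_fst] assms card_whites fin
    by (intro card_subset_eq) (auto simp: through_def)
  have snd_through: "snd ` through = {b. white q b}"
    using card_image[OF inj_snd] assms card_whites fin
    by (intro card_subset_eq) (auto simp: through_def)
  have partner: "\<exists>b. (a, b) \<in> through" if "white p a" for a using that fst_through by force
  have partner': "\<exists>a. (a, b) \<in> through" if "white q b" for b using that snd_through by force
  have comp: "v = a" if "white p a" "(a, v) \<in> E\<^sup>*" "white p v \<or> isolated p v" for a v
    using partner[OF that(1)] that through_component(1)[of a _ v] by (auto simp: through_def)
  have uniq: "s = t" if "s < r" "t < r" "(whites p ! s, v) \<in> E\<^sup>*" "(whites p ! t, v) \<in> E\<^sup>*" for s t v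
  proof -
    have "whites p ! t = whites p ! s"
      using comp[OF white_nth(3)[OF that(1)]] that white_nth(3)[OF that(2)]
      by (meson conn_sym rtrancl_trans)
    then show ?thesis
      using distinct_whites[of p] whites_p_length that by (simp add: nth_eq_iff_index_eq)
  qed
  define c where "c v = (if \<exists>s<r. (whites p ! s, v) \<in> E\<^sup>*
    then Suc (THE s. s < r \<and> (whites p ! s, v) \<in> E\<^sup>*) else 0)" for v
  have c: "c v = Suc s" if "s < r" "(whites p ! s, v) \<in> E\<^sup>*" for s v
  proof -
    have "(THE s. s < r \<and> (whites p ! s, v) \<in> E\<^sup>*) = s"
      using that uniq by (intro the_equality) auto
    then show ?thesis using that by (auto simp: c_def)
  qed
  have c0: "c v = 0" if "\<And>s. s < r \<Longrightarrow> (whites p ! s, v) \<notin> E\<^sup>*" for v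
    using that by (auto simp: c_def)
  have cN: "c v \<le> r" for v
  proof (cases "\<exists>s<r. (whites p ! s, v) \<in> E\<^sup>*")
    case True
    then obtain s where "s < r" "(whites p ! s, v) \<in> E\<^sup>*" by blast
    then show ?thesis using c[of s v] by simp
  qed (use c0 in auto)
  have "paint c \<in> colourings (map c (whites p)) (map c (whites q))"
  proof (rule paint_in_colourings)
    show "c v \<le> N" for v using cN[of v] by (simp add: N_def)
  next
    fix v w assume "(v, w) \<in> E"
    then have "(a, v) \<in> E\<^sup>* \<longleftrightarrow> (a, w) \<in> E\<^sup>*" for a
      using sym_E by (meson rtrancl.rtrancl_into_rtrancl symD)
    then show "c v = c w" by (simp add: c_def)
  next
    fix v assume v: "isolated p v \<or> isolated q v"
    show "c v = 0"
    proof (rule c0)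
      fix s assume s: "s < r"
      note w = white_nth(3)[OF s]
      obtain b where b: "(whites p ! s, b) \<in> through" using partner[OF w] by blast
      show "(whites p ! s, v) \<notin> E\<^sup>*"
      proof
        assume conn: "(whites p ! s, v) \<in> E\<^sup>*"
        show False
          using v through_component[OF w _ _ conn, of b] b w by (auto simp: through_def isolated_def)
      qed
    qed
  qed
  moreover have "map c (whites p) = colours"
    by (rule nth_equalityI) (auto simp: whites_p_length colours colours_nth c)
  ultimately have ne: "colourings colours (map c (whites q)) \<noteq> {}" by auto
  have c_through: "\<exists>s<r. a = whites p ! s \<and> c b = Suc s" if "(a, b) \<in> through" for a b
    using that white_nth(1)[of a] c by (auto simp: through_def)
  have "inj_on c {b. white q b}"
  proof (rule inj_onI)
    fix b b' assume "b \<in> {b. white q b}" "b' \<in> {b. white q b}" and eq: "c b = c b'"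
    then obtain a a' where aa: "(a, b) \<in> through" "(a', b') \<in> through" using partner' by blast
    then have "a = a'" using c_through[of a b] c_through[of a' b'] eq by auto
    then show "b = b'" using aa inj_onD[OF inj_fst, of "(a, b)" "(a', b')"] by simp
  qed
  then have "distinct (map c (whites q))"
    by (simp add: distinct_map distinct_whites set_whites)
  moreover have "set (map c (whites q)) \<subseteq> {1..N}"
  proof
    fix d assume "d \<in> set (map c (whites q))"
    then obtain b where b: "white q b" "d = c b" by (auto simp: set_whites)
    then obtain a where "(a, b) \<in> through" using partner' by blast
    then show "d \<in> {1..N}" using c_through[of a b] b cN[of b] by (auto simp: N_def)
  qed
  ultimately show ?thesis
    using card_colourings[of colours "map c (whites q)"] colours ne finite_colourings whites_q_length
    by auto
qed

end

section \<open>Stacking diagrams\<close>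

fun column :: "lvl \<Rightarrow> nat" where
  "column (Up i) = i" | "column (Mi i) = i" | "column (Dn i) = i"

lemma image_doubletons:
  "(`) f ` {{g i, h j} | i j. P i j} = {{f (g i), f (h j)} | i j. P i j}"
proof (intro equalityI subsetI)
  fix e assume "e \<in> {{f (g i), f (h j)} | i j. P i j}"
  then obtain i j where "e = f ` {g i, h j}" "P i j" by auto
  then show "e \<in> (`) f ` {{g i, h j} | i j. P i j}" by blast
qed auto

lemma image_vertical:
  "(`) f ` {{g a, h a} | a. P a} = {{f (g a), f (h a)} | a. P a}"
proof (intro equalityI subsetI)
  fix e assume "e \<in> {{f (g a), f (h a)} | a. P a}"
  then obtain a where "e = f ` {g a, h a}" "P a" by auto
  then show "e \<in> (`) f ` {{g a, h a} | a. P a}" by blast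
qed auto

context two_paths
begin

abbreviation adjacency :: "(lvl \<times> lvl) set" where
  "adjacency \<equiv> adj (dpq p p) (dpq q q)"

lemma dpq_self:
  "dpq s s = {{B i, B j} | i j. paired s i j} \<union> {{T i, T j} | i j. paired s i j} \<union>
    {{T a, B a} | a. white s a}"
proof -
  have "{{T (whites s ! t), B (whites s ! t)} | t. t < length (whites s) \<and> t < length (whites s)} =
      (\<lambda>a. {T a, B a}) ` set (whites s)"
    by (auto simp: set_conv_nth)
  then show ?thesis unfolding dpq_def set_whites by auto
qed

lemma stackE1_eq:
  "stackE1 (dpq p p) = {{Mi i, Mi j} | i j. paired p i j} \<union> {{Up i, Up j} | i j. paired p i j} \<union>
    {{Up a, Mi a} | a. white p a}"
  unfolding stackE1_def dpq_self image_Un image_doubletons image_vertical lift1.simps ..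

lemma stackE2_eq:
  "stackE2 (dpq q q) = {{Dn i, Dn j} | i j. paired q i j} \<union> {{Mi i, Mi j} | i j. paired q i j} \<union>
    {{Mi a, Dn a} | a. white q a}"
  unfolding stackE2_def dpq_self image_Un image_doubletons image_vertical lift2.simps ..

lemma adjacency_iff:
  "(x, y) \<in> adjacency \<longleftrightarrow>
    (\<exists>i j. (i, j) \<in> edges p \<and> (x = Up i \<and> y = Up j \<or> x = Mi i \<and> y = Mi j)) \<or>
    (\<exists>i j. (i, j) \<in> edges q \<and> (x = Mi i \<and> y = Mi j \<or> x = Dn i \<and> y = Dn j)) \<or>
    (\<exists>a. white p a \<and> (x = Up a \<and> y = Mi a \<or> x = Mi a \<and> y = Up a)) \<or>
    (\<exists>b. white q b \<and> (x = Mi b \<and> y = Dn b \<or> x = Dn b \<and> y = Mi b))"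
  unfolding adj_def stackE1_eq stackE2_eq edges_def
  by (auto simp: doubleton_eq_iff dest: paired_bound)

lemma sym_adjacency: "sym adjacency"
  by (auto simp: sym_def adj_def insert_commute)

text \<open>The outer rows repeat the one-factors of the middle row and vertical edges stay in one
  column, so every edge projects to an edge of \<open>E\<close> or to a point.\<close>

lemma adjacency_column: "(x, y) \<in> adjacency\<^sup>* \<Longrightarrow> (column x, column y) \<in> E\<^sup>*"
proof (induction rule: rtrancl_induct)
  case (step y z)
  have "(column y, column z) \<in> E\<^sup>*"
    using step(2) unfolding adjacency_iff by (auto simp: E_def)
  then show ?case using step.IH by simp
qed simp

lemma middle_conn: "(i, j) \<in> E\<^sup>* \<Longrightarrow> (Mi i, Mi j) \<in> adjacency\<^sup>*"
proof (induction rule: rtrancl_induct)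
  case (step j l)
  have "(Mi j, Mi l) \<in> adjacency" using step(2) unfolding adjacency_iff by (auto simp: E_def)
  then show ?case using step.IH by simp
qed simp

lemma edges_not_white:
  "(i, j) \<in> edges p \<Longrightarrow> \<not> white p i \<and> \<not> white p j"
  "(i, j) \<in> edges q \<Longrightarrow> \<not> white q i \<and> \<not> white q j"
  using edges_matching[OF walk_p] edges_matching[OF walk_q] edges_sym by blast+

lemma top_component:
  "(Up a, y) \<in> adjacency\<^sup>* \<Longrightarrow> \<not> white p a \<Longrightarrow> \<exists>a'. y = Up a' \<and> \<not> white p a'"
proof (induction rule: rtrancl_induct)
  case (step y z)
  then obtain a' where "y = Up a'" "\<not> white p a'" by blast
  then show ?case using step(2) edges_not_white unfolding adjacency_iff by blast
qed simp

lemma bottom_component: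
  "(Dn b, y) \<in> adjacency\<^sup>* \<Longrightarrow> \<not> white q b \<Longrightarrow> \<exists>b'. y = Dn b' \<and> \<not> white q b'"
proof (induction rule: rtrancl_induct)
  case (step y z)
  then obtain b' where "y = Dn b'" "\<not> white q b'" by blast
  then show ?case using step(2) edges_not_white unfolding adjacency_iff by blast
qed simp

lemma top_bottom_conn: "(Up a, Dn b) \<in> adjacency\<^sup>* \<longleftrightarrow> (a, b) \<in> through"
proof
  assume *: "(Up a, Dn b) \<in> adjacency\<^sup>*"
  then have "(Dn b, Up a) \<in> adjacency\<^sup>*" using sym_rtrancl[OF sym_adjacency] by (auto dest: symD)
  then show "(a, b) \<in> through"
    using * top_component[of a "Dn b"] bottom_component[of b "Up a"] adjacency_column[OF *]
    by (auto simp: through_def)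
next
  assume "(a, b) \<in> through"
  then have ab: "white p a" "white q b" "(a, b) \<in> E\<^sup>*" by (auto simp: through_def)
  have "(Up a, Mi a) \<in> adjacency" "(Mi b, Dn b) \<in> adjacency"
    using ab(1,2) unfolding adjacency_iff by blast+
  then show "(Up a, Dn b) \<in> adjacency\<^sup>*"
    using middle_conn[OF ab(3)]
    by (meson converse_rtrancl_into_rtrancl rtrancl.rtrancl_into_rtrancl)
qed

lemma rank_compose: "rank (compose (dpq p p) (dpq q q)) = card through"
proof -
  have "{T i, B j} \<in> compose (dpq p p) (dpq q q) \<longleftrightarrow> (Up i, Dn j) \<in> adjacency\<^sup>*" for i j
  proof
    assume "{T i, B j} \<in> compose (dpq p p) (dpq q q)"
    then obtain x y where xy: "{T i, B j} = {lower x, lower y}" "is_outer x" "is_outer y"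
      "(x, y) \<in> adjacency\<^sup>*" by (auto simp: compose_def)
    then have "x = Up i \<and> y = Dn j \<or> x = Dn j \<and> y = Up i"
      by (cases x; cases y) (auto simp: doubleton_eq_iff)
    then show "(Up i, Dn j) \<in> adjacency\<^sup>*"
      using xy(4) sym_rtrancl[OF sym_adjacency] by (auto dest: symD)
  next
    assume "(Up i, Dn j) \<in> adjacency\<^sup>*"
    then show "{T i, B j} \<in> compose (dpq p p) (dpq q q)"
      unfolding compose_def by (intro CollectI exI[of _ "Up i"] exI[of _ "Dn j"]) auto
  qed
  then have "{(i, j). {T i, B j} \<in> compose (dpq p p) (dpq q q)} = through"
    by (auto simp: top_bottom_conn)
  then show ?thesis by (simp add: rank_def)
qed

lemma touches_middle:
  "touches (stackE1 (dpq p p)) (Mi i) \<longleftrightarrow> (\<exists>j. (i, j) \<in> edges p) \<or> white p i"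
  "touches (stackE2 (dpq q q)) (Mi i) \<longleftrightarrow> (\<exists>j. (i, j) \<in> edges q) \<or> white q i"
proof -
  have "touches X v \<longleftrightarrow> (\<exists>w. {v, w} \<in> X)" if "\<forall>e\<in>X. \<exists>v w. e = {v, w}" for X v
    using that unfolding touches_def by (metis insert_commute insert_iff singletonD)
  moreover have "\<forall>e\<in>stackE1 (dpq p p). \<exists>v w. e = {v, w}" "\<forall>e\<in>stackE2 (dpq q q). \<exists>v w. e = {v, w}"
    unfolding stackE1_eq stackE2_eq by blast+
  moreover have "{Mi i, w} \<in> stackE1 (dpq p p) \<longleftrightarrow>
      (\<exists>j. w = Mi j \<and> (i, j) \<in> edges p) \<or> w = Up i \<and> white p i" for w
    unfolding stackE1_eq edges_def by (auto simp: doubleton_eq_iff)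
  moreover have "{Mi i, w} \<in> stackE2 (dpq q q) \<longleftrightarrow>
      (\<exists>j. w = Mi j \<and> (i, j) \<in> edges q) \<or> w = Dn i \<and> white q i" for w
    unfolding stackE2_eq edges_def by (auto simp: doubleton_eq_iff)
  ultimately show "touches (stackE1 (dpq p p)) (Mi i) \<longleftrightarrow> (\<exists>j. (i, j) \<in> edges p) \<or> white p i"
    "touches (stackE2 (dpq q q)) (Mi i) \<longleftrightarrow> (\<exists>j. (i, j) \<in> edges q) \<or> white q i"
    by auto
qed

text \<open>\<open>touches\<close> also accepts vertical edges, but these lead to an outer vertex. A
  component of middle vertices therefore has only horizontal edges and is a loop of
  \<open>E\<close>.\<close>

lemma n_loops_eq: "n_loops (dpq p p) (dpq q q) = card loops"
proof -
  let ?good = "\<lambda>w. \<not> is_outer w \<and> touches (stackE1 (dpq p p)) w \<and> touches (stackE2 (dpq q q)) w"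
  have class_eq: "adjacency\<^sup>* `` {Mi i} = Mi ` (E\<^sup>* `` {i})" if "E\<^sup>* `` {i} \<in> loops" for i
  proof (intro equalityI subsetI)
    fix w assume "w \<in> adjacency\<^sup>* `` {Mi i}"
    then have "(Mi i, w) \<in> adjacency\<^sup>*" by simp
    then have "\<exists>j. w = Mi j \<and> (i, j) \<in> E\<^sup>*"
    proof (induction rule: rtrancl_induct)
      case (step w z)
      then obtain j where j: "w = Mi j" "(i, j) \<in> E\<^sup>*" by blast
      then have "\<not> white p j" "\<not> white q j"
        using that edges_not_white unfolding loops_class_iff by blast+
      then obtain l where "z = Mi l" "(j, l) \<in> E"
        using step(2) j(1) unfolding adjacency_iff E_def by blast
      then show ?case using j(2) by auto
    qed simp
    then show "w \<in> Mi ` (E\<^sup>* `` {i})" by auto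
  qed (auto intro: middle_conn)
  have "{C. \<exists>v. C = adjacency\<^sup>* `` {v} \<and> (\<forall>w\<in>C. ?good w)} = (`) Mi ` loops"
  proof (intro equalityI subsetI)
    fix C assume "C \<in> {C. \<exists>v. C = adjacency\<^sup>* `` {v} \<and> (\<forall>w\<in>C. ?good w)}"
    then obtain v where v: "C = adjacency\<^sup>* `` {v}" and good: "\<And>w. w \<in> C \<Longrightarrow> ?good w" by blast
    have "v \<in> C" using v by simp
    then obtain i where i: "v = Mi i" using good[of v] by (cases v) auto
    have "(\<exists>l. (j, l) \<in> edges p) \<and> (\<exists>l. (j, l) \<in> edges q)" if j: "(i, j) \<in> E\<^sup>*" for j
    proof -
      have C: "Mi j \<in> C" using middle_conn[OF j] v i by simp
      have "\<not> white p j"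
      proof
        assume "white p j"
        then have "(Mi j, Up j) \<in> adjacency" unfolding adjacency_iff by blast
        then have "Up j \<in> C" using C v by (auto intro: rtrancl.rtrancl_into_rtrancl)
        then show False using good by fastforce
      qed
      moreover have "\<not> white q j"
      proof
        assume "white q j"
        then have "(Mi j, Dn j) \<in> adjacency" unfolding adjacency_iff by blast
        then have "Dn j \<in> C" using C v by (auto intro: rtrancl.rtrancl_into_rtrancl)
        then show False using good by fastforce
      qed
      ultimately show ?thesis using good[OF C] by (simp add: touches_middle)
    qed
    then have "E\<^sup>* `` {i} \<in> loops" by (simp add: loops_class_iff)
    then show "C \<in> (`) Mi ` loops" using class_eq v i by blast
  next
    fix C assume "C \<in> (`) Mi ` loops"
    then obtain i where i: "C = Mi ` (E\<^sup>* `` {i})" "E\<^sup>* `` {i} \<in> loops"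
      by (auto elim: loopsE)
    have "?good w" if "w \<in> C" for w
      using that i by (auto simp: touches_middle loops_class_iff)
    then show "C \<in> {C. \<exists>v. C = adjacency\<^sup>* `` {v} \<and> (\<forall>w\<in>C. ?good w)}"
      using class_eq[OF i(2)] i(1) by blast
  qed
  moreover have "inj_on ((`) Mi) loops"
    by (intro inj_onI) (simp add: inj_image_eq_iff inj_def)
  ultimately show ?thesis by (simp add: n_loops_def card_image)
qed

text \<open>By \<open>card_through\<close> and \<open>ev_of_through\<close>, the product keeps rank
  \<open>r\<close> exactly when \<open>ev\<close> is not \<open>None\<close>.\<close>

lemma bform_eq_ev:
  "bform r p q = (case ev (word 0 p) (word 0 q) of None \<Rightarrow> 0 | Some n \<Rightarrow> xf ^ n)"
  using card_through card_loops ev_of_through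
  by (auto simp: bform_def Let_def rank_compose n_loops_eq split: option.splits)

end

theorem gram_det_eq:
  assumes "k \<le> r + 2 * K + 1"
  shows "gram_det k r =
    (\<Prod>s = 1..K. (cheb_u (s + r) (xf - 1) / cheb_u (s - 1) (xf - 1)) ^ motz_m k (r + 2 * s))"
proof -
  \<comment> \<open>The loop value is left as \<open>y + 1\<close> with \<open>y = xf - 1\<close>,
    the form in which the path model states it.\<close>
  have "bform r p q = (case ev (word 0 p) (word 0 q) of None \<Rightarrow> 0 | Some n \<Rightarrow> (xf - 1 + 1) ^ n)"
    if "p \<in> motzkin_paths k r" "q \<in> motzkin_paths k r" for p q
  proof -
    interpret two_paths p q k r using that by unfold_locales
    show ?thesis by (simp add: bform_eq_ev split: option.split)
  qed
  then show ?thesis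
    unfolding gram_det_def path.prod_wt[OF assms, symmetric] by (rule path.det_path_gram)
qed

theorem mainTheorem16:
  fixes k r :: nat
  assumes "k \<ge> 1" and "r \<le> k"
  shows "gram_det k r =
           (\<Prod>s = 1..(k - r) div 2.
              (cheb_u (s + r) (xf - 1) / cheb_u (s - 1) (xf - 1)) ^ motz_m k (r + 2 * s))
       \<and> gram_det k k = 1 \<and> gram_det k (k - 1) = 1
       \<and> (k \<ge> 2 \<longrightarrow> gram_det k (k - 2) = cheb_u (k - 1) (xf - 1))
       \<and> (k \<ge> 3 \<longrightarrow> gram_det k (k - 3) = cheb_u (k - 2) (xf - 1) ^ k)"
proof (intro conjI impI)
  show "gram_det k r = (\<Prod>s = 1..(k - r) div 2.
      (cheb_u (s + r) (xf - 1) / cheb_u (s - 1) (xf - 1)) ^ motz_m k (r + 2 * s))"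
    by (rule gram_det_eq) (use assms in linarith)
  \<comment> \<open>The slack of 1 in the bound on \<open>K\<close> admits the empty product for
    rank \<open>k\<close> and also for rank \<open>k - 1\<close>.\<close>
  show "gram_det k k = 1" using gram_det_eq[of k k 0] by simp
  show "gram_det k (k - 1) = 1" using gram_det_eq[of k "k - 1" 0] by simp
  show "gram_det k (k - 2) = cheb_u (k - 1) (xf - 1)" if "k \<ge> 2"
  proof -
    have "k - 2 + 2 * 1 = k" "1 + (k - 2) = k - 1" using that by auto
    then show ?thesis
      using gram_det_eq[of k "k - 2" 1] path.motz_m_self[of k] by (simp del: cheb_u.simps(2,3))
  qed
  show "gram_det k (k - 3) = cheb_u (k - 2) (xf - 1) ^ k" if "k \<ge> 3"
  proof -
    \<comment> \<open>Only \<open>s = 1\<close> remains; its exponent counts the paths of rank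
      \<open>k - 1\<close>, which have one flat step in any of \<open>k\<close> positions.\<close>
    have "k - 3 + 2 * 1 = k - 1" "1 + (k - 3) = k - 2" "Suc (k - 1) = k" using that by auto
    then show ?thesis
      using gram_det_eq[of k "k - 3" 1] path.motz_m_pred[of "k - 1"]
      by (simp del: cheb_u.simps(2,3))
  qed
qed

end
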